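(* A point $p^*=(d^*,\omega^*,\phi^*,P^*,\lambda^*,\pi^*,\rho^{+*},\rho^{-*})$ is an equilibrium point of the closed-loop system (network dynamics together with load-side control, given in the context) if and only if there exist $\theta^*$ and $\nu^*$ such that $(d^*,\omega^*,\theta^* )$ is an optimal solution of OLC and $(d^*,\omega^*,\phi^*,P^*,\lambda^*,\nu^*,\pi^*,\rho^{+*},\rho^{-*})$ is a primal-dual optimal solution of VF-OLC, with $$\omega^*=\nu^*,\qquad CP^*=L_B\theta^*\qquad\text{and}\qquad C^T\theta^*=C^T\phi^*.$$
   Context: Network. $(\mathcal N,\mathcal E)$ is a finite connected directed graph with $ij\in\mathcal E\Rightarrow ji\notin\mathcal E$; $\mathcal N_i$ is the set of neighbors of $i$ (ignoring orientation); $\mathcal N=\mathcal G\cup\mathcal L$ is a partition into generator and load buses. Each line $e=ij$ has susceptance $B_{ij}=B_{ji}>0$; $B=\mathrm{diag}(B_e)_{e\in\mathcal E}$. $C\in\mathbb R^{|\mathcal N|\times|\mathcal E|}$ is the incidence matrix: for $e=ij$, $C_{i,e}=1$, $C_{j,e}=-1$, and other entries are $0$. $L_B=CBC^T$. $D_i>0$ for $i\in\mathcal N$, $D=\mathrm{diag}(D_i)$, $M_i>0$ for $i\in\mathcal G$; $P^{in}\in\mathbb R^{|\mathcal N|}$ is given. Areas. $\mathcal K$ is the finite set of control areas, $\mathcal N_k\subseteq\mathcal N$ the buses of area $k$, $\mathcal B_k\subseteq\mathcal E$ the edges with exactly one endpoint in $\mathcal N_k$. $\hat C\in\mathbb R^{|\mathcal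 K|\times|\mathcal E|}$: for $ij\in\mathcal B_k$, $\hat C_{k,ij}=1$ if $i\in\mathcal N_k$ and $-1$ if $j\in\mathcal N_k$; $\hat C_{k,ij}=0$ if $ij\notin\mathcal B_k$. $\hat P\in\mathbb R^{|\mathcal K|}$ and the limits $\overline P,\underline P=-\overline P\in\mathbb R^{|\mathcal E|}$ are given. Assumption 1: $c_i$ is $\alpha$-strongly convex and $C^2$ ($c_i''\ge\alpha>0$) in the interior of $\mathcal D_i=[\underline d_i,\overline d_i]\subseteq\mathbb R$ (possibly unbounded), and $c_i(d_i)\to+\infty$ as $d_i\to\partial\mathcal D_i$. OLC: minimize $\sum_{i}c_i(d_i)$ over $(d,\omega,\theta)$ subject to $P^{in}-(d+D\omega)=L_B\theta$, $\omega=0$, $\hat CBC^T\theta=\hat P$, $\underline P\le BC^T\theta\le\overline P$. VF-OLC: minimize $\sum_i\big(c_i(d_i)+\tfrac{D_i\omega_i^2}{2}\big)$ over $(d,\omega,\phi,P)$ subject to (a) $P^{in}-(d+D\omega)=CP$, (b) $P^{in}-d=L_B\phi$, (c) $\hat CBC^T\phi=\hat P$, (d) $\underline P\le BC^T\phi\le\overline P$. The Lagrange multipliers are $\nu\in\mathbb R^{|\mathcal N|}$ for (a), $\lambda\in\mathbb R^{|\mathcal N|}$ for (b), $\pi\in\mathbb R^{|\mathcal K|}$ for (c), and $\rho^+,\rho^-\in\mathbb R^{|\mathcal E|}_{\ge0}$ for the right and left inequalities in (d), with Lagrangian $\sum_i(c_i(d_i)+\tfrac{D_i\omega_i^2}{2})+\nu^T(P^{in}-(d+D\omega)-CP)+\lambda^T(P^{in}-d-L_B\phi)+\pi^T(\hat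 CBC^T\phi-\hat P)+\rho^{+T}(BC^T\phi-\overline P)+\rho^{-T}(\underline P-BC^T\phi)$. Assumption 2: OLC is feasible and has at least one feasible $(d,\omega,\theta)$ with $d\in\prod_i\mathrm{Int}\,\mathcal D_i$. Closed-loop system, with positive gains $\zeta,\chi$: $M_i\dot\omega_i=P_i^{in}-(d_i+D_i\omega_i)-\sum_{e}C_{i,e}P_e$ for $i\in\mathcal G$; $0=P_i^{in}-(d_i+D_i\omega_i)-\sum_{e}C_{i,e}P_e$ for $i\in\mathcal L$; $\dot P_{ij}=B_{ij}(\omega_i-\omega_j)$ for $ij\in\mathcal E$; $\dot\lambda_i=\zeta_i^\lambda\big(P_i^{in}-d_i-\sum_{j\in\mathcal N_i}B_{ij}(\phi_i-\phi_j)\big)$; $\dot\pi_k=\zeta_k^\pi\big(\sum_{ij\in\mathcal B_k}\hat C_{k,ij}B_{ij}(\phi_i-\phi_j)-\hat P_k\big)$; $\dot\rho^+_{ij}=\zeta^{\rho^+}_{ij}[B_{ij}(\phi_i-\phi_j)-\overline P_{ij}]^+_{\rho^+_{ij}}$; $\dot\rho^-_{ij}=\zeta^{\rho^-}_{ij}[\underline P_{ij}-B_{ij}(\phi_i-\phi_j)]^+_{\rho^-_{ij}}$; $\dot\phi_i=\chi_i^\phi\big(\sum_{j\in\mathcal N_i}B_{ij}(\lambda_i-\lambda_j)-\sum_{k\in\mathcal K,e\in\mathcal B_k}C_{i,e}B_e\hat C_{k,e}\pi_k-\sum_{e}C_{i,e}B_e(\rho_e^+-\rho_e^-)\big)$;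 $d_i=(c_i')^{-1}(\lambda_i+\omega_i)$. Here $[a]^+_u=a$ if $a>0$ or $u>0$, and $0$ otherwise. The state space is restricted to $\rho^+\ge0$, $\rho^-\ge0$ (preserved by the dynamics). An equilibrium point is a point satisfying the algebraic equations at which all time derivatives vanish. *)

theory Defs
  imports "HOL-Analysis.Analysis"
begin

(* The vertex set is the whole of the finite type 'n, and an edge ij is the pair (i, j).  The
   edges and the areas are subsets of 'n \<times> 'n and 'k (types cannot be empty, whereas a
   one-bus network has no lines); the space of real vectors indexed by S is the coordinate
   subspace vec_on S. *)

definition vec_on :: "'a set \<Rightarrow> (real ^ 'a) set" where
  "vec_on S = {x. \<forall>i. i \<notin> S \<longrightarrow> x $ i = 0}"

definition diag_mat :: "real ^ 'a \<Rightarrow> real ^ 'a ^ 'a" where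
  "diag_mat v = (\<chi> i j. if i = j then v $ i else 0)"

record ('n::finite, 'k::finite) network =
  gens :: "'n set"
  loads :: "'n set"
  lines :: "('n \<times> 'n) set"
  susc :: "'n \<Rightarrow> 'n \<Rightarrow> real"
  damp :: "real ^ 'n"
  inertia :: "'n \<Rightarrow> real"
  p_in :: "real ^ 'n"
  areas :: "'k set"
  area_buses :: "'k \<Rightarrow> 'n set"
  p_hat :: "real ^ 'k"
  p_max :: "real ^ ('n \<times> 'n)"
  cost :: "'n \<Rightarrow> real \<Rightarrow> real"
  d_lo :: "'n \<Rightarrow> ereal"
  d_hi :: "'n \<Rightarrow> ereal"

definition wf_network :: "('n::finite, 'k::finite) network \<Rightarrow> bool" where
  "wf_network N \<longleftrightarrow>
     gens N \<union> loads N = UNIV \<and> gens N \<inter> loads N = {} \<and>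
     (\<forall>i j. (i, j) \<in> lines N \<longrightarrow> (j, i) \<notin> lines N) \<and>
     (\<forall>i j. (i, j) \<in> (lines N \<union> (lines N)\<inverse>)\<^sup>*) \<and>
     (\<forall>i j. (i, j) \<in> lines N \<longrightarrow> susc N i j = susc N j i \<and> susc N i j > 0) \<and>
     (\<forall>i. damp N $ i > 0) \<and>
     (\<forall>i\<in>gens N. inertia N i > 0) \<and>
     p_hat N \<in> vec_on (areas N) \<and>
     p_max N \<in> vec_on (lines N)"

definition nbrs :: "('n::finite, 'k::finite) network \<Rightarrow> 'n \<Rightarrow> 'n set" where
  "nbrs N i = {j. (i, j) \<in> lines N \<or> (j, i) \<in> lines N}"

definition border :: "('n::finite, 'k::finite) network \<Rightarrow> 'k \<Rightarrow> ('n \<times> 'n) set" where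
  "border N k = {(i, j). (i, j) \<in> lines N \<and> (i \<in> area_buses N k) \<noteq> (j \<in> area_buses N k)}"

definition Bmat :: "('n::finite, 'k::finite) network \<Rightarrow> real ^ ('n \<times> 'n) ^ ('n \<times> 'n)" where
  "Bmat N = diag_mat (\<chi> e. if e \<in> lines N then susc N (fst e) (snd e) else 0)"

definition Cmat :: "('n::finite, 'k::finite) network \<Rightarrow> real ^ ('n \<times> 'n) ^ 'n" where
  "Cmat N = (\<chi> i e. if e \<in> lines N \<and> i = fst e then 1
                    else if e \<in> lines N \<and> i = snd e then -1 else 0)"

definition LB :: "('n::finite, 'k::finite) network \<Rightarrow> real ^ 'n ^ 'n" where
  "LB N = Cmat N ** Bmat N ** transpose (Cmat N)"

definition Chat :: "('n::finite, 'k::finite) network \<Rightarrow> real ^ ('n \<times> 'n) ^ 'k" where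
  "Chat N = (\<chi> k e. if k \<in> areas N \<and> e \<in> border N k
                    then (if fst e \<in> area_buses N k then 1 else -1) else 0)"

definition p_min :: "('n::finite, 'k::finite) network \<Rightarrow> real ^ ('n \<times> 'n)" where
  "p_min N = - p_max N"

definition line_flow :: "('n::finite, 'k::finite) network \<Rightarrow> real ^ 'n \<Rightarrow> real ^ ('n \<times> 'n)" where
  "line_flow N \<theta> = (Bmat N ** transpose (Cmat N)) *v \<theta>"

definition D_mat :: "('n::finite, 'k::finite) network \<Rightarrow> real ^ 'n ^ 'n" where
  "D_mat N = diag_mat (damp N)"

definition d_dom :: "('n::finite, 'k::finite) network \<Rightarrow> 'n \<Rightarrow> real set" where
  "d_dom N i = {x. d_lo N i \<le> ereal x \<and> ereal x \<le> d_hi N i}"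

definition strongly_convex_on :: "real \<Rightarrow> real set \<Rightarrow> (real \<Rightarrow> real) \<Rightarrow> bool" where
  "strongly_convex_on \<alpha> S f \<longleftrightarrow> convex S \<and>
     (\<forall>x\<in>S. \<forall>y\<in>S. \<forall>t\<in>{0..1}.
        f (t * x + (1 - t) * y) \<le> t * f x + (1 - t) * f y - \<alpha> / 2 * t * (1 - t) * (x - y)\<^sup>2)"

definition C2_on :: "real set \<Rightarrow> (real \<Rightarrow> real) \<Rightarrow> bool" where
  "C2_on S f \<longleftrightarrow>
     (\<forall>x\<in>S. f field_differentiable at x \<and> deriv f field_differentiable at x) \<and>
     continuous_on S (deriv (deriv f))"

definition assumption1 :: "('n::finite, 'k::finite) network \<Rightarrow> real \<Rightarrow> bool" where
  "assumption1 N \<alpha> \<longleftrightarrow> \<alpha> > 0 \<and>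
     (\<forall>i. strongly_convex_on \<alpha> (interior (d_dom N i)) (cost N i) \<and>
          C2_on (interior (d_dom N i)) (cost N i) \<and>
          (\<forall>x\<in>interior (d_dom N i). deriv (deriv (cost N i)) x \<ge> \<alpha>) \<and>
          (\<forall>b\<in>frontier (d_dom N i).
             filterlim (cost N i) at_top (at b within interior (d_dom N i))))"

(* The extended-real cost: the blow-up of the cost at the boundary of its domain forces the
   value \<infinity> there, and \<infinity> outside the domain encodes the constraint to the domain. *)
definition ext_cost :: "('n::finite, 'k::finite) network \<Rightarrow> 'n \<Rightarrow> real \<Rightarrow> ereal" where
  "ext_cost N i x = (if x \<in> interior (d_dom N i) then ereal (cost N i x) else \<infinity>)"

type_synonym 'n olc_point = "(real ^ 'n) \<times> (real ^ 'n) \<times> (real ^ 'n)"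

fun olc_objective :: "('n::finite, 'k::finite) network \<Rightarrow> 'n olc_point \<Rightarrow> ereal" where
  "olc_objective N (d, \<omega>, \<theta>) = (\<Sum>i\<in>UNIV. ext_cost N i (d $ i))"

fun olc_feasible :: "('n::finite, 'k::finite) network \<Rightarrow> 'n olc_point \<Rightarrow> bool" where
  "olc_feasible N (d, \<omega>, \<theta>) \<longleftrightarrow>
     p_in N - (d + D_mat N *v \<omega>) = LB N *v \<theta> \<and>
     \<omega> = 0 \<and>
     Chat N *v line_flow N \<theta> = p_hat N \<and>
     (\<forall>e\<in>lines N. p_min N $ e \<le> line_flow N \<theta> $ e \<and> line_flow N \<theta> $ e \<le> p_max N $ e)"

abbreviation olc_optimal :: "('n::finite, 'k::finite) network \<Rightarrow> 'n olc_point \<Rightarrow> bool" where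
  "olc_optimal N \<equiv> is_arg_min (olc_objective N) (olc_feasible N)"

definition assumption2 :: "('n::finite, 'k::finite) network \<Rightarrow> bool" where
  "assumption2 N \<longleftrightarrow>
     (\<exists>d \<omega> \<theta>. olc_feasible N (d, \<omega>, \<theta>) \<and> (\<forall>i. d $ i \<in> interior (d_dom N i)))"

(* (d, \<omega>, \<phi>, P) *)
type_synonym 'n vf_primal = "(real ^ 'n) \<times> (real ^ 'n) \<times> (real ^ 'n) \<times> (real ^ ('n \<times> 'n))"

(* (\<nu>, lam, \<pi>, \<rho>\<^sup>+, \<rho>\<^sup>-) *)
type_synonym ('n, 'k) vf_dual =
  "(real ^ 'n) \<times> (real ^ 'n) \<times> (real ^ 'k) \<times> (real ^ ('n \<times> 'n)) \<times> (real ^ ('n \<times> 'n))"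

fun vf_objective :: "('n::finite, 'k::finite) network \<Rightarrow> 'n vf_primal \<Rightarrow> ereal" where
  "vf_objective N (d, \<omega>, \<phi>, P) =
     (\<Sum>i\<in>UNIV. ext_cost N i (d $ i) + ereal (damp N $ i * (\<omega> $ i)\<^sup>2 / 2))"

fun vf_feasible :: "('n::finite, 'k::finite) network \<Rightarrow> 'n vf_primal \<Rightarrow> bool" where
  "vf_feasible N (d, \<omega>, \<phi>, P) \<longleftrightarrow>
     P \<in> vec_on (lines N) \<and>
     p_in N - (d + D_mat N *v \<omega>) = Cmat N *v P \<and>
     p_in N - d = LB N *v \<phi> \<and>
     Chat N *v line_flow N \<phi> = p_hat N \<and>
     (\<forall>e\<in>lines N. p_min N $ e \<le> line_flow N \<phi> $ e \<and> line_flow N \<phi> $ e \<le> p_max N $ e)"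

fun vf_lagrangian ::
  "('n::finite, 'k::finite) network \<Rightarrow> 'n vf_primal \<Rightarrow> ('n, 'k) vf_dual \<Rightarrow> ereal" where
  "vf_lagrangian N (d, \<omega>, \<phi>, P) (\<nu>, lam, \<pi>, \<rho>p, \<rho>m) =
     vf_objective N (d, \<omega>, \<phi>, P) +
     ereal (\<nu> \<bullet> (p_in N - (d + D_mat N *v \<omega>) - Cmat N *v P)
          + lam \<bullet> (p_in N - d - LB N *v \<phi>)
          + \<pi> \<bullet> (Chat N *v line_flow N \<phi> - p_hat N)
          + \<rho>p \<bullet> (line_flow N \<phi> - p_max N)
          + \<rho>m \<bullet> (p_min N - line_flow N \<phi>))"

definition vf_dual_objective ::
  "('n::finite, 'k::finite) network \<Rightarrow> ('n, 'k) vf_dual \<Rightarrow> ereal" where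
  "vf_dual_objective N y =
     (INF x \<in> {(d, \<omega>, \<phi>, P). P \<in> vec_on (lines N)}. vf_lagrangian N x y)"

fun vf_dual_feasible :: "('n::finite, 'k::finite) network \<Rightarrow> ('n, 'k) vf_dual \<Rightarrow> bool" where
  "vf_dual_feasible N (\<nu>, lam, \<pi>, \<rho>p, \<rho>m) \<longleftrightarrow>
     \<pi> \<in> vec_on (areas N) \<and> \<rho>p \<in> vec_on (lines N) \<and> \<rho>m \<in> vec_on (lines N) \<and>
     (\<forall>e\<in>lines N. \<rho>p $ e \<ge> 0 \<and> \<rho>m $ e \<ge> 0)"

definition vf_primal_dual_optimal ::
  "('n::finite, 'k::finite) network \<Rightarrow> 'n vf_primal \<Rightarrow> ('n, 'k) vf_dual \<Rightarrow> bool" where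
  "vf_primal_dual_optimal N x y \<longleftrightarrow>
     is_arg_min (vf_objective N) (vf_feasible N) x \<and>
     is_arg_max (vf_dual_objective N) (vf_dual_feasible N) y"

record ('n, 'k) gains =
  g_lam :: "'n \<Rightarrow> real"
  g_pi :: "'k \<Rightarrow> real"
  g_rhop :: "'n \<times> 'n \<Rightarrow> real"
  g_rhom :: "'n \<times> 'n \<Rightarrow> real"
  g_phi :: "'n \<Rightarrow> real"

definition positive_gains :: "('n::finite, 'k::finite) network \<Rightarrow> ('n, 'k) gains \<Rightarrow> bool" where
  "positive_gains N g \<longleftrightarrow>
     (\<forall>i. g_lam g i > 0) \<and> (\<forall>k\<in>areas N. g_pi g k > 0) \<and>
     (\<forall>e\<in>lines N. g_rhop g e > 0 \<and> g_rhom g e > 0) \<and> (\<forall>i. g_phi g i > 0)"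

definition pos_proj :: "real \<Rightarrow> real \<Rightarrow> real" where
  "pos_proj u a = (if a > 0 \<or> u > 0 then a else 0)"

(* (d, \<omega>, \<phi>, P, lam, \<pi>, \<rho>\<^sup>+, \<rho>\<^sup>-) *)
type_synonym ('n, 'k) cl_point =
  "(real ^ 'n) \<times> (real ^ 'n) \<times> (real ^ 'n) \<times> (real ^ ('n \<times> 'n)) \<times>
   (real ^ 'n) \<times> (real ^ 'k) \<times> (real ^ ('n \<times> 'n)) \<times> (real ^ ('n \<times> 'n))"

fun state_space :: "('n::finite, 'k::finite) network \<Rightarrow> ('n, 'k) cl_point \<Rightarrow> bool" where
  "state_space N (d, \<omega>, \<phi>, P, lam, \<pi>, \<rho>p, \<rho>m) \<longleftrightarrow>
     P \<in> vec_on (lines N) \<and> \<pi> \<in> vec_on (areas N) \<and>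
     \<rho>p \<in> vec_on (lines N) \<and> \<rho>m \<in> vec_on (lines N) \<and>
     (\<forall>e\<in>lines N. \<rho>p $ e \<ge> 0 \<and> \<rho>m $ e \<ge> 0)"

(* The differential-algebraic system as a relation between a point and its time derivative.
   The derivatives of d and of \<omega> at load buses do not occur.  Under assumption1 the derivative
   of the cost maps the interior of the domain bijectively onto the reals, so inv_into is its
   genuine inverse. *)
fun closed_loop :: "('n::finite, 'k::finite) network \<Rightarrow> ('n, 'k) gains \<Rightarrow>
    ('n, 'k) cl_point \<Rightarrow> ('n, 'k) cl_point \<Rightarrow> bool" where
  "closed_loop N g (d, \<omega>, \<phi>, P, lam, \<pi>, \<rho>p, \<rho>m) (d', \<omega>', \<phi>', P', lam', \<pi>', \<rho>p', \<rho>m') \<longleftrightarrow>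
     (\<forall>i\<in>gens N. inertia N i * \<omega>' $ i =
        p_in N $ i - (d $ i + damp N $ i * \<omega> $ i) - (\<Sum>e\<in>lines N. Cmat N $ i $ e * P $ e)) \<and>
     (\<forall>i\<in>loads N. 0 =
        p_in N $ i - (d $ i + damp N $ i * \<omega> $ i) - (\<Sum>e\<in>lines N. Cmat N $ i $ e * P $ e)) \<and>
     (\<forall>(i, j)\<in>lines N. P' $ (i, j) = susc N i j * (\<omega> $ i - \<omega> $ j)) \<and>
     (\<forall>i. lam' $ i = g_lam g i *
        (p_in N $ i - d $ i - (\<Sum>j\<in>nbrs N i. susc N i j * (\<phi> $ i - \<phi> $ j)))) \<and>
     (\<forall>k\<in>areas N. \<pi>' $ k = g_pi g k *
        ((\<Sum>(i, j)\<in>border N k. Chat N $ k $ (i, j) * susc N i j * (\<phi> $ i - \<phi> $ j)) - p_hat N $ k)) \<and>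
     (\<forall>(i, j)\<in>lines N. \<rho>p' $ (i, j) = g_rhop g (i, j) *
        pos_proj (\<rho>p $ (i, j)) (susc N i j * (\<phi> $ i - \<phi> $ j) - p_max N $ (i, j))) \<and>
     (\<forall>(i, j)\<in>lines N. \<rho>m' $ (i, j) = g_rhom g (i, j) *
        pos_proj (\<rho>m $ (i, j)) (p_min N $ (i, j) - susc N i j * (\<phi> $ i - \<phi> $ j))) \<and>
     (\<forall>i. \<phi>' $ i = g_phi g i *
        ((\<Sum>j\<in>nbrs N i. susc N i j * (lam $ i - lam $ j))
         - (\<Sum>k\<in>areas N. \<Sum>e\<in>border N k.
              Cmat N $ i $ e * Bmat N $ e $ e * Chat N $ k $ e * \<pi> $ k)
         - (\<Sum>e\<in>lines N. Cmat N $ i $ e * Bmat N $ e $ e * (\<rho>p $ e - \<rho>m $ e)))) \<and>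
     (\<forall>i. d $ i = inv_into (interior (d_dom N i)) (deriv (cost N i)) (lam $ i + \<omega> $ i))"

definition equilibrium ::
  "('n::finite, 'k::finite) network \<Rightarrow> ('n, 'k) gains \<Rightarrow> ('n, 'k) cl_point \<Rightarrow> bool" where
  "equilibrium N g p \<longleftrightarrow> state_space N p \<and> closed_loop N g p 0"

end

theory Submission
  imports Defs
begin

text \<open>
  The equations of an equilibrium are the Karush-Kuhn-Tucker conditions of VF-OLC, so the theorem
  is strong duality for that problem together with the fact that both sides force \<open>\<omega> = 0\<close>.

  \<^bold>\<open>The frequency vanishes.\<close> At an equilibrium the flows on lines stand still, hence \<open>\<omega>\<close> is constant
  on the connected network. The physical and the virtual power balance both sum to zero over the
  buses, because the columns of the incidence matrix do; their difference says that the positive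
  combination \<open>\<Sum>i. D\<^sub>i \<omega>\<^sub>i\<close> is zero (\<open>synchronized_balanced_imp_zero_frequency\<close>). On the optimization
  side, \<open>\<omega> = 0\<close> is a constraint of OLC, and \<open>\<nu> = \<omega>\<close> is then zero as well. So only Lagrangians with
  \<open>\<nu> = 0\<close> matter, and in those \<open>\<phi>\<close> occurs linearly; its coefficient is, up to sign and gains,
  the drift of \<open>\<phi>\<close> in the closed loop (\<open>vf_lagrangian_interior\<close>).

  \<^bold>\<open>Equilibria are KKT points.\<close> The predicate \<open>kkt\<close> collects the conditions on \<open>d\<close>, \<open>\<phi>\<close> and the
  multipliers. That the load response \<open>(c\<^sub>i')\<^sup>-\<^sup>1\<close> takes values in the interior of the domain and
  inverts \<open>c\<^sub>i'\<close> needs \<open>c\<^sub>i'\<close> to map that interior bijectively onto the reals, which is where the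
  blow-up of the costs and the strong convexity enter (\<open>marginal_cost_bij_betw\<close>). The projected
  dynamics of \<open>\<rho>\<^sup>+\<close> and \<open>\<rho>\<^sup>-\<close> stand still exactly under the line limits and complementary slackness.

  \<^bold>\<open>KKT points are optimal.\<close> By convexity a KKT point minimizes the Lagrangian, so its primal value
  equals its dual value (\<open>kkt_no_duality_gap\<close>) and weak duality makes both optimal. Taking \<open>\<theta> = \<phi>\<close>
  gives an optimum of OLC, since every feasible point of OLC yields one of VF-OLC of the same cost.

  \<^bold>\<open>Optimal points are KKT points.\<close> An optimal dual point is only known to be at least as good as
  other dual points, so some dual point attaining the primal value has to be produced first.
  All constraints are linear, hence Farkas' lemma applied to the feasible directions at the primal
  optimum gives such multipliers (\<open>vf_optimal_imp_kkt\<close>). Therefore the given pair is a saddle point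
  of the Lagrangian, and the first-order conditions can be read off
  (\<open>vf_primal_dual_optimal_imp_kkt\<close>).
\<close>

section \<open>Strongly convex costs on an open interval\<close>

text \<open>If \<open>f'\<close> stayed below \<open>s\<close>, then on an interval bounded above \<open>f\<close> would grow at most linearly from
  \<open>p\<close> and could not blow up at the right endpoint; on an unbounded interval \<open>f'\<close> itself grows at
  rate at least \<open>\<alpha>\<close>.\<close>

lemma derivative_attains_large_values:
  fixes f f' f'' :: "real \<Rightarrow> real"
  assumes "open I" "convex I" "p \<in> I" "\<alpha> > 0"
    and f': "\<And>x. x \<in> I \<Longrightarrow> (f has_real_derivative f' x) (at x)"
    and f'': "\<And>x. x \<in> I \<Longrightarrow> (f' has_real_derivative f'' x) (at x)"
    and ge: "\<And>x. x \<in> I \<Longrightarrow> f'' x \<ge> \<alpha>"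
    and blowup: "\<And>b. b \<in> closure I - I \<Longrightarrow> filterlim f at_top (at b within I)"
  shows "\<exists>x\<in>I. f' x \<ge> s"
proof (rule ccontr)
  assume "\<not> ?thesis"
  then have lt: "f' x < s" if "x \<in> I" for x using that by force
  have seg: "z \<in> I" if "p \<le> z" "z \<le> x" "x \<in> I" for z x
    using that assms(2,3) by (meson atLeastAtMost_iff is_interval_convex_1 mem_is_interval_1_I)
  show False
  proof (cases "bdd_above I")
    case True
    define b where "b = Sup I"
    have "b \<in> closure I"
      unfolding b_def using closure_contains_Sup[of I] True assms(3) by auto
    have le_b: "x \<le> b" if "x \<in> I" for x
      unfolding b_def using that True by (rule cSup_upper)
    have "b \<notin> I"
    proof
      assume "b \<in> I"
      then obtain e where "e > 0" "cball b e \<subseteq> I"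
        using assms(1) open_contains_cball by blast
      moreover from this have "b + e \<in> I" by (auto simp: dist_real_def subset_iff)
      ultimately show False using le_b by fastforce
    qed
    with \<open>b \<in> closure I\<close> have b: "b \<in> closure I - I" by simp
    have "p < b" using le_b[OF assms(3)] \<open>b \<notin> I\<close> assms(3) by (metis order_le_less)
    have "b islimpt I" using b by (auto simp: closure_def)
    then have nontriv: "at b within I \<noteq> bot" by (simp add: trivial_limit_within)
    have "eventually (\<lambda>x. f x > f p + \<bar>s\<bar> * (b - p)) (at b within I)"
      using blowup[OF b] by (simp add: filterlim_at_top_dense)
    moreover have "eventually (\<lambda>x. x > p) (at b within I)"
      using \<open>p < b\<close> tendsto_ident_at by (rule order_tendstoD(1)[rotated])
    moreover have "eventually (\<lambda>x. x \<in> I) (at b within I)"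
      by (simp add: eventually_at_filter)
    ultimately have "eventually (\<lambda>x. f x > f p + \<bar>s\<bar> * (b - p) \<and> x > p \<and> x \<in> I) (at b within I)"
      by (intro eventually_conj)
    then obtain x where x: "f x > f p + \<bar>s\<bar> * (b - p)" "x > p" "x \<in> I"
      using nontriv eventually_happens by blast
    obtain z where z: "p < z" "z < x" "f x - f p = (x - p) * f' z"
      using MVT2[of p x f f'] x(2,3) f' seg by blast
    have "(x - p) * f' z \<le> (x - p) * \<bar>s\<bar>"
      using lt[of z] seg[of z x] z x by (intro mult_left_mono) auto
    also have "\<dots> \<le> (b - p) * \<bar>s\<bar>"
      using le_b[OF x(3)] by (intro mult_right_mono) auto
    finally show False using z x by (simp add: mult.commute)
  next
    case False
    then obtain x where x: "x \<in> I" "x > p + \<bar>s - f' p\<bar> / \<alpha>"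
      by (meson bdd_above.I not_le)
    have "\<bar>s - f' p\<bar> / \<alpha> \<ge> 0" using assms(4) by simp
    then have "p < x" using x by linarith
    obtain z where z: "p < z" "z < x" "f' x - f' p = (x - p) * f'' z"
      using MVT2[of p x f' f''] \<open>p < x\<close> x(1) f'' seg by blast
    have "\<bar>s - f' p\<bar> < (x - p) * \<alpha>" using x(2) assms(4) by (simp add: field_simps)
    also have "\<dots> \<le> (x - p) * f'' z"
      using ge seg[of z x] z x \<open>p < x\<close> by (intro mult_left_mono) auto
    finally show False using z lt[OF x(1)] by linarith
  qed
qed

text \<open>The mirror image \<open>x \<mapsto> f (- x)\<close> gives small values of \<open>f'\<close> from the preceding lemma; the
  intermediate value theorem does the rest.\<close>

lemma derivative_surjective:
  fixes f f' f'' :: "real \<Rightarrow> real"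
  assumes "open I" "convex I" "I \<noteq> {}" "\<alpha> > 0"
    and f': "\<And>x. x \<in> I \<Longrightarrow> (f has_real_derivative f' x) (at x)"
    and f'': "\<And>x. x \<in> I \<Longrightarrow> (f' has_real_derivative f'' x) (at x)"
    and ge: "\<And>x. x \<in> I \<Longrightarrow> f'' x \<ge> \<alpha>"
    and blowup: "\<And>b. b \<in> closure I - I \<Longrightarrow> filterlim f at_top (at b within I)"
  shows "\<exists>x\<in>I. f' x = s"
proof -
  obtain p where "p \<in> I" using assms(3) by blast
  then obtain u where u: "u \<in> I" "f' u \<ge> s"
    using derivative_attains_large_values[of I p \<alpha> f f' f'' s] assms by blast
  have "\<exists>x\<in>uminus ` I. - f' (- x) \<ge> - s"
  proof (rule derivative_attains_large_values[where p = "- p" and \<alpha> = \<alpha>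
        and f = "\<lambda>x. f (- x)" and f'' = "\<lambda>x. f'' (- x)"])
    show "open (uminus ` I)" using assms(1) by (rule open_negations)
    show "convex (uminus ` I)" using assms(2) by (rule convex_negations)
    show "filterlim (\<lambda>x. f (- x)) at_top (at b within uminus ` I)"
      if "b \<in> closure (uminus ` I) - uminus ` I" for b
    proof -
      have "closure (uminus ` I) = uminus ` closure I"
        using closure_injective_linear_image[of "uminus :: real \<Rightarrow> real" I]
        by (simp add: linear_uminus)
      with that have "- b \<in> closure I - I" by force
      moreover have "filterlim uminus (at (- b) within I) (at b within uminus ` I)"
        unfolding filterlim_at
        by (auto simp: eventually_at_filter intro!: always_eventually tendsto_eq_intros)
      ultimately show ?thesis
        using filterlim_compose[OF blowup] by blast
    qed
  next
    show "((\<lambda>x. f (- x)) has_real_derivative - f' (- x)) (at x)" if "x \<in> uminus ` I" for x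
      using that f' by (auto simp: DERIV_mirror[symmetric])
    show "((\<lambda>x. - f' (- x)) has_real_derivative f'' (- x)) (at x)" if "x \<in> uminus ` I" for x
    proof -
      have "((\<lambda>x. f' (- x)) has_real_derivative - f'' (- x)) (at x)"
        using that f'' by (auto simp: DERIV_mirror[symmetric])
      from DERIV_minus[OF this] show ?thesis by simp
    qed
  qed (use \<open>p \<in> I\<close> assms in auto)
  then obtain v where v: "v \<in> I" "f' v \<le> s" by force
  have "connected (f' ` I)"
    using assms(2) f'' by (intro connected_continuous_image convex_connected
        continuous_at_imp_continuous_on ballI DERIV_isCont)
  then have "s \<in> f' ` I"
    using u v by (meson connected_contains_Icc atLeastAtMost_iff imageI subsetD)
  then show ?thesis by blast
qed

lemma cost_derivatives:
  assumes "assumption1 N \<alpha>" "x \<in> interior (d_dom N i)"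
  shows "(cost N i has_real_derivative deriv (cost N i) x) (at x)"
    and "(deriv (cost N i) has_real_derivative deriv (deriv (cost N i)) x) (at x)"
    and "deriv (deriv (cost N i)) x \<ge> \<alpha>"
  using assms unfolding assumption1_def C2_on_def
  by (auto simp: field_differentiable_derivI)

lemma convex_interior_d_dom:
  assumes "assumption1 N \<alpha>"
  shows "convex (interior (d_dom N i))"
  using assms unfolding assumption1_def strongly_convex_on_def by blast

lemma cost_above_tangent:
  assumes "assumption1 N \<alpha>" "x \<in> interior (d_dom N i)" "y \<in> interior (d_dom N i)"
  shows "cost N i y \<ge> cost N i x + deriv (cost N i) x * (y - x)"
proof -
  have "convex_on (interior (d_dom N i)) (cost N i)"
    using cost_derivatives[OF assms(1)] assms(1) convex_interior_d_dom[OF assms(1)]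
    by (intro f''_ge0_imp_convex[where f' = "deriv (cost N i)" and f'' = "deriv (deriv (cost N i))"])
       (auto simp: assumption1_def intro: order_trans[of 0 \<alpha>])
  then show ?thesis
    using convex_on_imp_above_tangent[of "interior (d_dom N i)" "cost N i" x y
        "deriv (cost N i) x"] assms convex_interior_d_dom[OF assms(1)]
      cost_derivatives(1)[OF assms(1,2)]
    by (auto simp: convex_connected has_field_derivative_at_within)
qed

lemma marginal_cost_bij_betw:
  assumes "assumption1 N \<alpha>" "interior (d_dom N i) \<noteq> {}"
  shows "bij_betw (deriv (cost N i)) (interior (d_dom N i)) UNIV"
proof (rule bij_betw_imageI)
  let ?I = "interior (d_dom N i)"
  note D = cost_derivatives[OF assms(1), of _ i]
  have "\<alpha> > 0" using assms(1) by (simp add: assumption1_def)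
  have "closure ?I - ?I \<subseteq> frontier (d_dom N i)"
    unfolding frontier_def using closure_mono[OF interior_subset] by blast
  then have "filterlim (cost N i) at_top (at b within ?I)" if "b \<in> closure ?I - ?I" for b
    using that assms(1) unfolding assumption1_def by blast
  then show "deriv (cost N i) ` ?I = UNIV"
    using derivative_surjective[OF open_interior convex_interior_d_dom[OF assms(1)] assms(2)
        \<open>\<alpha> > 0\<close> D] by (auto simp: image_iff) metis
  have less: "deriv (cost N i) x < deriv (cost N i) y" if "x \<in> ?I" "y \<in> ?I" "x < y" for x y
  proof (rule DERIV_pos_imp_increasing[OF \<open>x < y\<close>])
    fix z assume "x \<le> z" "z \<le> y"
    then have "z \<in> ?I"
      using that convex_interior_d_dom[OF assms(1)]
      by (meson is_interval_convex_1 mem_is_interval_1_I)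
    then show "\<exists>u. (deriv (cost N i) has_real_derivative u) (at z) \<and> 0 < u"
      using D(2)[of z] D(3)[of z] \<open>\<alpha> > 0\<close> by (meson less_le_trans)
  qed
  show "inj_on (deriv (cost N i)) ?I"
    by (rule linorder_inj_onI') (use less in fastforce)
qed

section \<open>Incidence algebra\<close>

lemma diag_mat_mult_nth: "(diag_mat v *v x) $ i = v $ i * x $ i"
proof -
  have "(diag_mat v *v x) $ i = (\<Sum>j\<in>UNIV. if i = j then v $ i * x $ j else 0)"
    unfolding matrix_vector_mult_def diag_mat_def
    by (simp add: if_distrib[of "\<lambda>c. c * _"] cong: if_cong)
  then show ?thesis by simp
qed

lemma transpose_diag_mat: "transpose (diag_mat v) = diag_mat v"
  by (simp add: transpose_def diag_mat_def vec_eq_iff)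

lemma no_loops:
  assumes "wf_network N"
  shows "(i, i) \<notin> lines N"
  using assms unfolding wf_network_def by blast

lemma transpose_Cmat_nth:
  assumes "wf_network N"
  shows "(transpose (Cmat N) *v x) $ (i, j) = (if (i, j) \<in> lines N then x $ i - x $ j else 0)"
proof -
  have "(transpose (Cmat N) *v x) $ (i, j) = (\<Sum>k\<in>UNIV.
      if (i, j) \<in> lines N then (if k = i then x $ i else 0) - (if k = j then x $ j else 0) else 0)"
    unfolding matrix_vector_mult_def transpose_def Cmat_def
    using no_loops[OF assms] by (auto intro!: sum.cong)
  then show ?thesis by (simp add: sum_subtractf)
qed

lemma line_flow_nth:
  assumes "wf_network N"
  shows "line_flow N x $ (i, j) = (if (i, j) \<in> lines N then susc N i j * (x $ i - x $ j) else 0)"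
  unfolding line_flow_def Bmat_def matrix_vector_mul_assoc[symmetric] diag_mat_mult_nth
  by (simp add: transpose_Cmat_nth[OF assms] del: transpose_matrix_vector)

lemma line_flow_linear: "linear (line_flow N)"
  unfolding line_flow_def by (rule matrix_vector_mul_linear)

lemma LB_eq_line_flow: "LB N *v x = Cmat N *v line_flow N x"
  unfolding LB_def line_flow_def by (simp add: matrix_vector_mul_assoc matrix_mul_assoc)

lemma inner_transpose: "x \<bullet> (A *v y) = (transpose A *v x) \<bullet> (y :: real ^ 'n)"
  by (metis dot_lmul_matrix vector_transpose_matrix transpose_transpose)

lemma inner_line_flow: "u \<bullet> line_flow N h = (Cmat N *v (Bmat N *v u)) \<bullet> h"
  unfolding line_flow_def
  by (simp add: inner_transpose matrix_transpose_mul matrix_vector_mul_assoc Bmat_def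
      transpose_diag_mat)

lemma inner_LB: "x \<bullet> (LB N *v h) = (LB N *v x) \<bullet> h"
  by (simp add: inner_transpose LB_def matrix_transpose_mul matrix_mul_assoc Bmat_def
      transpose_diag_mat)

lemma Cmat_mult_nth: "(Cmat N *v P) $ i = (\<Sum>e\<in>lines N. Cmat N $ i $ e * P $ e)"
  unfolding matrix_vector_mult_def
  by (simp, rule sum.mono_neutral_right) (auto simp: Cmat_def)

lemma Chat_mult_nth: "(Chat N *v P) $ k = (\<Sum>e\<in>border N k. Chat N $ k $ e * P $ e)"
  unfolding matrix_vector_mult_def
  by (simp, rule sum.mono_neutral_right) (auto simp: Chat_def)

text \<open>Every column of the incidence matrix has one entry \<open>1\<close> and one entry \<open>- 1\<close>, or is zero: power
  leaving one bus arrives at another.\<close>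

lemma sum_Cmat_mult:
  assumes "wf_network N"
  shows "(\<Sum>i\<in>UNIV. (Cmat N *v P) $ i) = 0"
proof -
  have "transpose (Cmat N) *v 1 = 0"
    by (simp add: vec_eq_iff split_paired_all transpose_Cmat_nth[OF assms] del: transpose_matrix_vector)
  then have "1 \<bullet> (Cmat N *v P) = 0" by (simp add: inner_transpose del: transpose_matrix_vector)
  then show ?thesis by (simp add: inner_vec_def)
qed

text \<open>Lines out of \<open>i\<close> and lines into \<open>i\<close> contribute terms of the same form, and no neighbour is
  counted twice because no line occurs in both orientations.\<close>

lemma LB_mult_nth:
  assumes "wf_network N"
  shows "(LB N *v x) $ i = (\<Sum>j\<in>nbrs N i. susc N i j * (x $ i - x $ j))"
proof -
  let ?out = "{j. (i, j) \<in> lines N}" and ?in = "{j. (j, i) \<in> lines N}"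
  let ?f = "\<lambda>j. susc N i j * (x $ i - x $ j)"
  have asym: "?out \<inter> ?in = {}" and sym: "\<And>j. j \<in> ?in \<Longrightarrow> susc N j i = susc N i j"
    using assms unfolding wf_network_def by blast+
  have "(LB N *v x) $ i = (\<Sum>e\<in>lines N. Cmat N $ i $ e * line_flow N x $ e)"
    by (simp add: LB_eq_line_flow Cmat_mult_nth)
  also have "\<dots> = (\<Sum>e\<in>Pair i ` ?out \<union> (\<lambda>j. (j, i)) ` ?in. Cmat N $ i $ e * line_flow N x $ e)"
    by (rule sum.mono_neutral_right) (auto simp: Cmat_def)
  also have "\<dots> = (\<Sum>e\<in>Pair i ` ?out. Cmat N $ i $ e * line_flow N x $ e)
      + (\<Sum>e\<in>(\<lambda>j. (j, i)) ` ?in. Cmat N $ i $ e * line_flow N x $ e)"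
    using no_loops[OF assms] by (intro sum.union_disjoint) auto
  also have "(\<Sum>e\<in>Pair i ` ?out. Cmat N $ i $ e * line_flow N x $ e) = sum ?f ?out"
    by (subst sum.reindex) (auto simp: inj_on_def Cmat_def line_flow_nth[OF assms])
  also have "(\<Sum>e\<in>(\<lambda>j. (j, i)) ` ?in. Cmat N $ i $ e * line_flow N x $ e) = sum ?f ?in"
    using no_loops[OF assms] sym
    by (subst sum.reindex)
       (auto simp: inj_on_def Cmat_def line_flow_nth[OF assms] algebra_simps intro!: sum.cong)
  also have "sum ?f ?out + sum ?f ?in = sum ?f (?out \<union> ?in)"
    using asym by (intro sum.union_disjoint[symmetric]) auto
  also have "?out \<union> ?in = nbrs N i" by (auto simp: nbrs_def)
  finally show ?thesis .
qed

lemma constant_on_network: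
  assumes "wf_network N" and eq: "\<And>i j. (i, j) \<in> lines N \<Longrightarrow> x $ i = x $ j"
  shows "x $ i = x $ j"
proof -
  have "(i, j) \<in> (lines N \<union> (lines N)\<inverse>)\<^sup>*"
    using assms(1) unfolding wf_network_def by blast
  then show ?thesis by induction (use eq in auto)
qed

section \<open>The Lagrangian with vanishing frequency multiplier\<close>

text \<open>Up to the gains, the right-hand side of the closed-loop equation for \<open>\<phi>\<close>, in matrix form. It is
  also minus the gradient in \<open>\<phi>\<close> of the Lagrangian of VF-OLC.\<close>

definition virtual_phase_drift ::
  "('n::finite, 'k::finite) network \<Rightarrow> real ^ 'n \<Rightarrow> real ^ 'k \<Rightarrow> real ^ ('n \<times> 'n) \<Rightarrow>
    real ^ ('n \<times> 'n) \<Rightarrow> real ^ 'n" where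
  "virtual_phase_drift N lam \<pi> \<rho>p \<rho>m =
     LB N *v lam - Cmat N *v (Bmat N *v (\<pi> v* Chat N + \<rho>p - \<rho>m))"

lemma inner_virtual_phase_drift:
  "virtual_phase_drift N lam \<pi> \<rho>p \<rho>m \<bullet> h =
     lam \<bullet> (LB N *v h) - \<pi> \<bullet> (Chat N *v line_flow N h) - \<rho>p \<bullet> line_flow N h + \<rho>m \<bullet> line_flow N h"
  unfolding virtual_phase_drift_def inner_diff_left inner_line_flow[symmetric] inner_LB[symmetric]
  by (simp add: inner_diff_left inner_add_left dot_lmul_matrix)

lemma vf_objective_interior:
  assumes "\<And>i. d $ i \<in> interior (d_dom N i)"
  shows "vf_objective N (d, \<omega>, \<phi>, P) =
    ereal (\<Sum>i\<in>UNIV. cost N i (d $ i) + damp N $ i * (\<omega> $ i)\<^sup>2 / 2)"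
  using assms by (simp add: ext_cost_def)

lemma vf_objective_not_interior:
  assumes "d $ i \<notin> interior (d_dom N i)"
  shows "vf_objective N (d, \<omega>, \<phi>, P) = \<infinity>"
  using assms by (auto simp: sum_Pinfty ext_cost_def)

lemma inner_nonpos_on:
  assumes "\<rho> \<in> vec_on S" "\<And>e. e \<in> S \<Longrightarrow> \<rho> $ e \<ge> 0" "\<And>e. e \<in> S \<Longrightarrow> a $ e \<le> 0"
  shows "\<rho> \<bullet> a \<le> 0"
proof -
  have "\<rho> $ e * a $ e \<le> 0" for e
    using assms by (cases "e \<in> S") (auto simp: vec_on_def mult_nonneg_nonpos)
  then show ?thesis by (simp add: inner_vec_def sum_nonpos)
qed

lemma inner_eq_0_imp_complementary:
  assumes "\<rho> \<in> vec_on S" "\<And>e. e \<in> S \<Longrightarrow> \<rho> $ e \<ge> 0" "\<And>e. e \<in> S \<Longrightarrow> a $ e \<le> 0"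
    and "\<rho> \<bullet> a = 0"
  shows "\<rho> $ e * a $ e = 0"
proof -
  have nonpos: "\<rho> $ e * a $ e \<le> 0" for e
    using assms by (cases "e \<in> S") (auto simp: vec_on_def mult_nonneg_nonpos)
  have "(\<Sum>e\<in>UNIV. - (\<rho> $ e * a $ e)) = 0"
    using assms(4) by (simp add: inner_vec_def sum_negf)
  then show ?thesis
    using nonpos by (subst (asm) sum_nonneg_eq_0_iff) auto
qed

text \<open>With \<open>\<nu> = 0\<close> the flow \<open>P\<close> drops out and the remaining variables separate: a scalar convex problem
  for each \<open>d\<^sub>i\<close>, a quadratic in \<open>\<omega>\<close>, and a linear term in \<open>\<phi>\<close>. The last summand does
  not depend on the primal point.\<close>

lemma vf_lagrangian_interior:
  assumes "\<And>i. d $ i \<in> interior (d_dom N i)"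
  shows "vf_lagrangian N (d, \<omega>, \<phi>, P) (0, lam, \<pi>, \<rho>p, \<rho>m) =
    ereal ((\<Sum>i\<in>UNIV. cost N i (d $ i) - lam $ i * d $ i) + (\<Sum>i\<in>UNIV. damp N $ i * (\<omega> $ i)\<^sup>2 / 2)
      - virtual_phase_drift N lam \<pi> \<rho>p \<rho>m \<bullet> \<phi>
      + (lam \<bullet> p_in N - \<pi> \<bullet> p_hat N - \<rho>p \<bullet> p_max N + \<rho>m \<bullet> p_min N))"
proof -
  have "(\<Sum>i\<in>UNIV. lam $ i * d $ i) = lam \<bullet> d" by (simp add: inner_vec_def)
  then show ?thesis
    unfolding vf_lagrangian.simps vf_objective_interior[OF assms] plus_ereal.simps
    by (simp add: inner_virtual_phase_drift inner_diff_right sum.distrib sum_subtractf)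
qed

section \<open>Optimality conditions\<close>

text \<open>Stated separately because \<open>P\<^sup>i\<^sup>n - d\<close> is the left-hand side of two of the equations, so that
  simplification would merge them.\<close>

lemma vf_feasible_zero_frequency:
  "vf_feasible N (d, 0, \<phi>, P) \<longleftrightarrow>
     P \<in> vec_on (lines N) \<and> p_in N - d = Cmat N *v P \<and> p_in N - d = LB N *v \<phi> \<and>
     Chat N *v line_flow N \<phi> = p_hat N \<and>
     (\<forall>e\<in>lines N. p_min N $ e \<le> line_flow N \<phi> $ e \<and> line_flow N \<phi> $ e \<le> p_max N $ e)"
  unfolding vf_feasible.simps matrix_vector_mult_0_right add_0_right ..

text \<open>The Karush-Kuhn-Tucker conditions of VF-OLC at \<open>\<omega> = 0\<close> and \<open>\<nu> = 0\<close>, without primal feasibility: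
  stationarity in \<open>d\<close> and in \<open>\<phi>\<close>, dual feasibility, complementary slackness. Stationarity in \<open>\<omega>\<close> and
  \<open>P\<close> is automatic for these values.\<close>

definition kkt ::
  "('n::finite, 'k::finite) network \<Rightarrow> real ^ 'n \<Rightarrow> real ^ 'n \<Rightarrow> real ^ 'n \<Rightarrow> real ^ 'k \<Rightarrow>
    real ^ ('n \<times> 'n) \<Rightarrow> real ^ ('n \<times> 'n) \<Rightarrow> bool" where
  "kkt N d \<phi> lam \<pi> \<rho>p \<rho>m \<longleftrightarrow>
     (\<forall>i. d $ i \<in> interior (d_dom N i) \<and> deriv (cost N i) (d $ i) = lam $ i) \<and>
     virtual_phase_drift N lam \<pi> \<rho>p \<rho>m = 0 \<and>
     vf_dual_feasible N (0, lam, \<pi>, \<rho>p, \<rho>m) \<and>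
     (\<forall>e\<in>lines N. (\<rho>p $ e > 0 \<longrightarrow> line_flow N \<phi> $ e = p_max N $ e) \<and>
                   (\<rho>m $ e > 0 \<longrightarrow> line_flow N \<phi> $ e = p_min N $ e))"

lemma inner_eq_of_complementary:
  assumes "\<rho> \<in> vec_on S" "\<And>e. e \<in> S \<Longrightarrow> \<rho> $ e \<ge> 0" "\<And>e. e \<in> S \<Longrightarrow> \<rho> $ e > 0 \<Longrightarrow> a $ e = b $ e"
  shows "\<rho> \<bullet> a = \<rho> \<bullet> b"
proof -
  have "\<rho> $ e * a $ e = \<rho> $ e * b $ e" for e
    using assms by (cases "e \<in> S") (force simp: vec_on_def less_le)+
  then show ?thesis unfolding inner_vec_def by (intro sum.cong) auto
qed

text \<open>At a feasible point the Lagrangian differs from the objective only by the inequality terms, which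
  are nonpositive.\<close>

lemma weak_duality:
  assumes "vf_feasible N x" "vf_dual_feasible N y"
  shows "vf_dual_objective N y \<le> vf_objective N x"
proof -
  obtain d \<omega> \<phi> P \<nu> lam \<pi> \<rho>p \<rho>m where x: "x = (d, \<omega>, \<phi>, P)" and y: "y = (\<nu>, lam, \<pi>, \<rho>p, \<rho>m)"
    by (metis prod_cases4 prod_cases5)
  have "\<rho>p \<bullet> (line_flow N \<phi> - p_max N) \<le> 0" "\<rho>m \<bullet> (p_min N - line_flow N \<phi>) \<le> 0"
    using assms unfolding x y by (auto intro!: inner_nonpos_on[where S = "lines N"])
  then have "vf_lagrangian N x y \<le> vf_objective N x + ereal 0"
    using assms unfolding x y vf_lagrangian.simps by (intro add_left_mono) auto
  then show ?thesis
    unfolding vf_dual_objective_def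
    using assms(1) by (intro INF_lower2[of x]) (auto simp: x)
qed

text \<open>Each part of the separated Lagrangian is minimized at the KKT point: the cost lies above its
  tangent of slope \<open>\<lambda>\<^sub>i\<close>, the quadratic in \<open>\<omega>\<close> is nonnegative, and the coefficient of \<open>\<phi>\<close> vanishes.
  Complementary slackness makes the minimum equal to the primal value.\<close>

lemma kkt_no_duality_gap:
  fixes N :: "('n::finite, 'k::finite) network"
  assumes wf: "wf_network N" and A1: "assumption1 N \<alpha>"
    and feas: "vf_feasible N (d, 0, \<phi>, P)" and kkt: "kkt N d \<phi> lam \<pi> \<rho>p \<rho>m"
  shows "vf_objective N (d, 0, \<phi>, P) \<le> vf_dual_objective N (0, lam, \<pi>, \<rho>p, \<rho>m)"
  unfolding vf_dual_objective_def
proof (rule INF_greatest)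
  fix x :: "'n vf_primal" assume "x \<in> {(d, \<omega>, \<phi>, P). P \<in> vec_on (lines N)}"
  obtain d' \<omega>' \<phi>' P' where x: "x = (d', \<omega>', \<phi>', P')" by (metis prod_cases4)
  have int: "d $ i \<in> interior (d_dom N i)" and price: "deriv (cost N i) (d $ i) = lam $ i" for i
    using kkt by (auto simp: kkt_def)
  have drift: "virtual_phase_drift N lam \<pi> \<rho>p \<rho>m = 0" using kkt by (simp add: kkt_def)
  have "\<rho>p \<bullet> line_flow N \<phi> = \<rho>p \<bullet> p_max N" "\<rho>m \<bullet> line_flow N \<phi> = \<rho>m \<bullet> p_min N"
    using kkt by (auto simp: kkt_def intro!: inner_eq_of_complementary[where S = "lines N"])
  moreover have "LB N *v \<phi> = p_in N - d" "Chat N *v line_flow N \<phi> = p_hat N"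
    using feas by auto
  ultimately have K: "lam \<bullet> d = lam \<bullet> p_in N - \<pi> \<bullet> p_hat N - \<rho>p \<bullet> p_max N + \<rho>m \<bullet> p_min N"
    using inner_virtual_phase_drift[of N lam \<pi> \<rho>p \<rho>m \<phi>] drift by (simp add: inner_diff_right)
  show "vf_objective N (d, 0, \<phi>, P) \<le> vf_lagrangian N x (0, lam, \<pi>, \<rho>p, \<rho>m)"
  proof (cases "\<forall>i. d' $ i \<in> interior (d_dom N i)")
    case True
    have "cost N i (d $ i) - lam $ i * d $ i \<le> cost N i (d' $ i) - lam $ i * d' $ i" for i
      using cost_above_tangent[OF A1 int True[rule_format], of i] price[of i]
      by (simp add: algebra_simps)
    then have "(\<Sum>i\<in>UNIV. cost N i (d $ i) - lam $ i * d $ i)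
        \<le> (\<Sum>i\<in>UNIV. cost N i (d' $ i) - lam $ i * d' $ i)"
      by (rule sum_mono)
    moreover have "0 \<le> (\<Sum>i\<in>UNIV. damp N $ i * (\<omega>' $ i)\<^sup>2 / 2)"
      using wf by (intro sum_nonneg) (auto simp: wf_network_def less_imp_le)
    moreover have "(\<Sum>i\<in>UNIV. lam $ i * d $ i) = lam \<bullet> d" by (simp add: inner_vec_def)
    ultimately show ?thesis
      unfolding x using True int drift K
      by (simp add: vf_objective_interior vf_lagrangian_interior sum_subtractf del: vf_objective.simps vf_lagrangian.simps)
  next
    case False
    then show ?thesis by (auto simp: x vf_objective_not_interior simp del: vf_objective.simps)
  qed
qed

lemma kkt_imp_vf_primal_dual_optimal:
  assumes "wf_network N" "assumption1 N \<alpha>"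
    and "vf_feasible N (d, 0, \<phi>, P)" "kkt N d \<phi> lam \<pi> \<rho>p \<rho>m"
  shows "vf_primal_dual_optimal N (d, 0, \<phi>, P) (0, lam, \<pi>, \<rho>p, \<rho>m)"
proof -
  have dual: "vf_dual_feasible N (0, lam, \<pi>, \<rho>p, \<rho>m)" using assms(4) unfolding kkt_def by blast
  note gap = kkt_no_duality_gap[OF assms]
  have "vf_objective N (d, 0, \<phi>, P) \<le> vf_objective N x" if "vf_feasible N x" for x
    using gap weak_duality[OF that dual] by (rule order_trans)
  moreover have "vf_dual_objective N y \<le> vf_dual_objective N (0, lam, \<pi>, \<rho>p, \<rho>m)"
    if "vf_dual_feasible N y" for y
    using weak_duality[OF assms(3) that] gap by (rule order_trans)
  ultimately show ?thesis
    unfolding vf_primal_dual_optimal_def is_arg_min_def is_arg_max_def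
    using assms(3) dual by (meson not_le)
qed

lemma line_flow_in_vec_on:
  assumes "wf_network N"
  shows "line_flow N \<theta> \<in> vec_on (lines N)"
  using assms by (auto simp: vec_on_def line_flow_nth)

lemma olc_feasible_imp_vf_feasible:
  assumes "wf_network N" "olc_feasible N (d, \<omega>, \<theta>)"
  shows "vf_feasible N (d, 0, \<theta>, line_flow N \<theta>)"
  using assms by (auto simp: line_flow_in_vec_on LB_eq_line_flow)

text \<open>OLC embeds into VF-OLC at equal cost: keep \<open>d\<close>, use \<open>\<theta>\<close> as the virtual phases, and let \<open>P\<close> be the
  line flow that \<open>\<theta>\<close> induces.\<close>

lemma vf_optimal_imp_olc_optimal:
  assumes wf: "wf_network N" and opt: "is_arg_min (vf_objective N) (vf_feasible N) (d, 0, \<phi>, P)"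
  shows "olc_optimal N (d, 0, \<phi>)"
  unfolding is_arg_min_def
proof (intro conjI notI)
  show "olc_feasible N (d, 0, \<phi>)" using opt by (auto simp: is_arg_min_def)
  assume "\<exists>y. olc_feasible N y \<and> olc_objective N y < olc_objective N (d, 0, \<phi>)"
  then obtain d' \<omega>' \<theta>' where feas: "olc_feasible N (d', \<omega>', \<theta>')"
    and less: "olc_objective N (d', \<omega>', \<theta>') < olc_objective N (d, 0, \<phi>)"
    by (metis prod_cases3)
  have "vf_objective N (d', 0, \<theta>', line_flow N \<theta>') < vf_objective N (d, 0, \<phi>, P)"
    using less by simp
  then show False
    using opt olc_feasible_imp_vf_feasible[OF wf feas] unfolding is_arg_min_def by blast
qed

text \<open>Off the interior the extended cost is infinite, and a feasible point of OLC with \<open>d\<close> in the interior beats that.\<close>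

lemma vf_optimal_imp_interior:
  assumes wf: "wf_network N" and A2: "assumption2 N"
    and opt: "is_arg_min (vf_objective N) (vf_feasible N) (d, \<omega>, \<phi>, P)"
  shows "d $ i \<in> interior (d_dom N i)"
proof (rule ccontr)
  assume "d $ i \<notin> interior (d_dom N i)"
  then have "vf_objective N (d, \<omega>, \<phi>, P) = \<infinity>" by (rule vf_objective_not_interior)
  moreover obtain d' \<omega>' \<theta> where feas: "olc_feasible N (d', \<omega>', \<theta>)"
    and "\<And>i. d' $ i \<in> interior (d_dom N i)"
    using A2 unfolding assumption2_def by blast
  ultimately have "vf_objective N (d', 0, \<theta>, line_flow N \<theta>) < vf_objective N (d, \<omega>, \<phi>, P)"
    by (simp add: vf_objective_interior del: vf_objective.simps)
  then show False
    using opt olc_feasible_imp_vf_feasible[OF wf feas] unfolding is_arg_min_def by blast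
qed

section \<open>Existence of multipliers\<close>

text \<open>A finitely generated cone is closed, so a point outside it is strictly separated from it. The
  negated normal vector of the separating hyperplane violates the assumption.\<close>

lemma farkas:
  fixes v :: "'a::euclidean_space"
  assumes "finite S" and v: "\<And>h. (\<And>s. s \<in> S \<Longrightarrow> s \<bullet> h \<le> 0) \<Longrightarrow> v \<bullet> h \<le> 0"
  shows "v \<in> convex_cone hull S"
proof (rule ccontr)
  let ?K = "convex_cone hull S"
  assume "v \<notin> ?K"
  then obtain a b where a: "a \<bullet> v < b" and b: "\<And>x. x \<in> ?K \<Longrightarrow> a \<bullet> x > b"
    using separating_hyperplane_closed_point[of ?K v] convex_convex_cone_hull
      closed_convex_cone_hull[OF assms(1)] by blast
  have "b < 0" using b[OF convex_cone_hull_contains_0] by simp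
  have "s \<bullet> (- a) \<le> 0" if "s \<in> S" for s
  proof (rule ccontr)
    assume "\<not> ?thesis"
    then have neg: "a \<bullet> s < 0" by (simp add: inner_commute)
    \<comment> \<open>The scaling puts the point exactly on the separating hyperplane.\<close>
    have "(b / (a \<bullet> s)) *\<^sub>R s \<in> ?K"
      using hull_inc[OF that] neg \<open>b < 0\<close>
      by (intro conicD[OF conic_convex_cone_hull]) (auto simp: divide_nonpos_nonpos)
    from b[OF this] show False using neg by simp
  qed
  from v[OF this] show False using a \<open>b < 0\<close> by (simp add: inner_commute)
qed

text \<open>The perturbation \<open>\<phi> + t h\<close> is completed to a feasible point by \<open>d - t L\<^sub>B h\<close> and by adding \<open>t\<close> times
  the flow of \<open>h\<close> to \<open>P\<close>. For small \<open>t > 0\<close> it keeps \<open>d\<close> in the open domain and respects the line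
  limits: the active ones by the assumptions on \<open>h\<close>, the others by continuity. If the derivative of
  the cost along \<open>h\<close> were negative, the optimum could be improved.\<close>

lemma vf_optimal_feasible_direction:
  assumes wf: "wf_network N" and A1: "assumption1 N \<alpha>"
    and opt: "is_arg_min (vf_objective N) (vf_feasible N) (d, 0, \<phi>, P)"
    and int: "\<And>i. d $ i \<in> interior (d_dom N i)"
    and area: "Chat N *v line_flow N h = 0"
    and up: "\<And>e. e \<in> lines N \<Longrightarrow> line_flow N \<phi> $ e = p_max N $ e \<Longrightarrow> line_flow N h $ e \<le> 0"
    and lo: "\<And>e. e \<in> lines N \<Longrightarrow> line_flow N \<phi> $ e = p_min N $ e \<Longrightarrow> line_flow N h $ e \<ge> 0"
  shows "(\<chi> i. deriv (cost N i) (d $ i)) \<bullet> (LB N *v h) \<le> 0"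
proof (rule ccontr)
  let ?v = "LB N *v h"
  let ?\<psi> = "\<lambda>t. \<Sum>i\<in>UNIV. cost N i (d $ i - t * ?v $ i)"
  assume "\<not> ?thesis"
  then have "(\<Sum>i\<in>UNIV. deriv (cost N i) (d $ i) * - ?v $ i) < 0"
    by (simp add: inner_vec_def sum_negf)
  moreover have "(?\<psi> has_real_derivative (\<Sum>i\<in>UNIV. deriv (cost N i) (d $ i) * - ?v $ i)) (at 0)"
  proof (rule DERIV_sum)
    fix i
    have "((\<lambda>t. d $ i - t * ?v $ i) has_real_derivative - ?v $ i) (at 0)"
      by (auto intro!: derivative_eq_intros)
    then show "((\<lambda>t. cost N i (d $ i - t * ?v $ i)) has_real_derivative
        deriv (cost N i) (d $ i) * - ?v $ i) (at 0)"
      using cost_derivatives(1)[OF A1 int[of i]]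
        DERIV_chain2[of "cost N i" "deriv (cost N i) (d $ i)" "\<lambda>t. d $ i - t * ?v $ i" 0 "- ?v $ i" UNIV]
      by simp
  qed
  ultimately obtain \<delta> where \<delta>: "\<delta> > 0" "\<And>t. 0 < t \<Longrightarrow> t < \<delta> \<Longrightarrow> ?\<psi> t < ?\<psi> 0"
    using DERIV_neg_dec_right[of ?\<psi> _ 0] by auto
  have "\<forall>\<^sub>F t in at_right 0. \<forall>i. d $ i - t * ?v $ i \<in> interior (d_dom N i)"
  proof (rule eventually_all_finite)
    fix i
    have "((\<lambda>t. d $ i - t * ?v $ i) \<longlongrightarrow> d $ i) (at_right 0)"
      by (auto intro!: tendsto_eq_intros)
    then show "\<forall>\<^sub>F t in at_right 0. d $ i - t * ?v $ i \<in> interior (d_dom N i)"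
      by (rule topological_tendstoD[OF _ open_interior int])
  qed
  moreover have "\<forall>\<^sub>F t in at_right 0. \<forall>e\<in>lines N.
      p_min N $ e \<le> line_flow N \<phi> $ e + t * line_flow N h $ e \<and>
      line_flow N \<phi> $ e + t * line_flow N h $ e \<le> p_max N $ e"
  proof (rule eventually_ball_finite, simp, rule ballI, rule eventually_conj)
    fix e assume e: "e \<in> lines N"
    have bounds: "p_min N $ e \<le> line_flow N \<phi> $ e" "line_flow N \<phi> $ e \<le> p_max N $ e"
      using opt e by (auto simp: is_arg_min_def)
    have pos: "\<forall>\<^sub>F t in at_right (0::real). 0 < t" by (simp add: eventually_at_right_less)
    have lim: "((\<lambda>t. line_flow N \<phi> $ e + t * line_flow N h $ e) \<longlongrightarrow> line_flow N \<phi> $ e) (at_right 0)"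
      by (auto intro!: tendsto_eq_intros)
    show "\<forall>\<^sub>F t in at_right 0. p_min N $ e \<le> line_flow N \<phi> $ e + t * line_flow N h $ e"
    proof (cases "line_flow N \<phi> $ e = p_min N $ e")
      case True
      then show ?thesis using lo[OF e True] by (intro eventually_mono[OF pos]) auto
    next
      case False
      then have "\<forall>\<^sub>F t in at_right 0. p_min N $ e < line_flow N \<phi> $ e + t * line_flow N h $ e"
        using bounds by (intro order_tendstoD(1)[OF lim]) auto
      then show ?thesis by (rule eventually_mono) simp
    qed
    show "\<forall>\<^sub>F t in at_right 0. line_flow N \<phi> $ e + t * line_flow N h $ e \<le> p_max N $ e"
    proof (cases "line_flow N \<phi> $ e = p_max N $ e")
      case True
      then show ?thesis
        using up[OF e True] by (intro eventually_mono[OF pos]) (auto simp: mult_nonneg_nonpos)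
    next
      case False
      then have "\<forall>\<^sub>F t in at_right 0. line_flow N \<phi> $ e + t * line_flow N h $ e < p_max N $ e"
        using bounds by (intro order_tendstoD(2)[OF lim]) auto
      then show ?thesis by (rule eventually_mono) simp
    qed
  qed
  moreover have "\<forall>\<^sub>F t in at_right 0. 0 < t \<and> t < \<delta>"
    using \<delta>(1) by (auto simp: eventually_at_right)
  ultimately have "\<forall>\<^sub>F t in at_right 0. (\<forall>i. d $ i - t * ?v $ i \<in> interior (d_dom N i)) \<and>
      (\<forall>e\<in>lines N. p_min N $ e \<le> line_flow N \<phi> $ e + t * line_flow N h $ e \<and>
        line_flow N \<phi> $ e + t * line_flow N h $ e \<le> p_max N $ e) \<and> 0 < t \<and> t < \<delta>"
    by eventually_elim blast
  then obtain t where t: "\<And>i. d $ i - t * ?v $ i \<in> interior (d_dom N i)"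
      "\<And>e. e \<in> lines N \<Longrightarrow> p_min N $ e \<le> line_flow N \<phi> $ e + t * line_flow N h $ e"
      "\<And>e. e \<in> lines N \<Longrightarrow> line_flow N \<phi> $ e + t * line_flow N h $ e \<le> p_max N $ e"
      "0 < t" "t < \<delta>"
    using eventually_happens[of _ "at_right (0::real)"] trivial_limit_at_right_real[of 0] by blast
  define x where "x = (d - t *\<^sub>R ?v, 0 :: real ^ 'a, \<phi> + t *\<^sub>R h, P + t *\<^sub>R line_flow N h)"
  have flow: "line_flow N (\<phi> + t *\<^sub>R h) = line_flow N \<phi> + t *\<^sub>R line_flow N h"
    using line_flow_linear[of N] by (simp add: linear_add linear_scale)
  have feas: "vf_feasible N (d, 0, \<phi>, P)" using opt unfolding is_arg_min_def by blast
  have balance: "p_in N - d = Cmat N *v P" "p_in N - d = LB N *v \<phi>"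
    and flow_area: "Chat N *v line_flow N \<phi> = p_hat N" and P: "P \<in> vec_on (lines N)"
    using feas unfolding vf_feasible_zero_frequency by blast+
  have "vf_feasible N x"
    unfolding x_def vf_feasible.simps flow
  proof (intro conjI ballI)
    show "P + t *\<^sub>R line_flow N h \<in> vec_on (lines N)"
      using P line_flow_in_vec_on[OF wf, of h] by (simp add: vec_on_def)
    have shift: "p_in N - (d - t *\<^sub>R ?v) = (p_in N - d) + t *\<^sub>R ?v" by simp
    show "p_in N - (d - t *\<^sub>R ?v) = LB N *v (\<phi> + t *\<^sub>R h)"
      unfolding shift balance(2) by (simp add: matrix_vector_right_distrib matrix_vector_mult_scaleR)
    have "p_in N - (d - t *\<^sub>R ?v) = Cmat N *v (P + t *\<^sub>R line_flow N h)"
      unfolding shift unfolding balance(1) LB_eq_line_flow[of N h]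
      by (simp add: matrix_vector_right_distrib matrix_vector_mult_scaleR)
    then show "p_in N - (d - t *\<^sub>R ?v + D_mat N *v 0) = Cmat N *v (P + t *\<^sub>R line_flow N h)"
      unfolding matrix_vector_mult_0_right add_0_right .
    show "Chat N *v (line_flow N \<phi> + t *\<^sub>R line_flow N h) = p_hat N"
      using flow_area area by (simp add: matrix_vector_right_distrib matrix_vector_mult_scaleR)
    fix e assume "e \<in> lines N"
    then show "p_min N $ e \<le> (line_flow N \<phi> + t *\<^sub>R line_flow N h) $ e"
      and "(line_flow N \<phi> + t *\<^sub>R line_flow N h) $ e \<le> p_max N $ e"
      using t(2,3) by auto
  qed
  moreover have "vf_objective N x < vf_objective N (d, 0, \<phi>, P)"
    using \<delta>(2)[of t] t int
    by (simp add: x_def vf_objective_interior del: vf_objective.simps)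
  ultimately show False using opt unfolding is_arg_min_def by blast
qed

text \<open>The price \<open>\<lambda>\<close> is read off from the marginal costs. What remains is to write \<open>L\<^sub>B \<lambda>\<close> as a combination
  of constraint gradients in \<open>\<phi>\<close>, with signs and supports as prescribed; the preceding lemma is the
  hypothesis of Farkas' lemma for this.\<close>

lemma vf_optimal_imp_kkt:
  fixes N :: "('n::finite, 'k::finite) network"
  assumes wf: "wf_network N" and A1: "assumption1 N \<alpha>"
    and opt: "is_arg_min (vf_objective N) (vf_feasible N) (d, 0, \<phi>, P)"
    and int: "\<And>i. d $ i \<in> interior (d_dom N i)"
  shows "\<exists>lam \<pi> \<rho>p \<rho>m. kkt N d \<phi> lam \<pi> \<rho>p \<rho>m"
proof -
  define lam :: "real ^ 'n" where "lam = (\<chi> i. deriv (cost N i) (d $ i))"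
  \<comment> \<open>\<open>push\<close> is the combination of constraint gradients with the given coefficients, \<open>adm\<close> says that
    the coefficients are admissible multipliers, and \<open>K\<close> is the cone of the resulting combinations.
    It suffices that \<open>K\<close> contains the cone generated by the gradients \<open>S\<close> of the active constraints,
    where an equality constraint contributes both signs.\<close>
  define push :: "real ^ 'k \<Rightarrow> real ^ ('n \<times> 'n) \<Rightarrow> real ^ ('n \<times> 'n) \<Rightarrow> real ^ 'n"
    where "push = (\<lambda>\<pi> \<rho>p \<rho>m. Cmat N *v (Bmat N *v (\<pi> v* Chat N + \<rho>p - \<rho>m)))"
  define adm :: "real ^ 'k \<Rightarrow> real ^ ('n \<times> 'n) \<Rightarrow> real ^ ('n \<times> 'n) \<Rightarrow> bool"
    where "adm = (\<lambda>\<pi> \<rho>p \<rho>m. vf_dual_feasible N (0, lam, \<pi>, \<rho>p, \<rho>m) \<and>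
      (\<forall>e\<in>lines N. (line_flow N \<phi> $ e \<noteq> p_max N $ e \<longrightarrow> \<rho>p $ e = 0) \<and>
                    (line_flow N \<phi> $ e \<noteq> p_min N $ e \<longrightarrow> \<rho>m $ e = 0)))"
  define K where "K = {push \<pi> \<rho>p \<rho>m | \<pi> \<rho>p \<rho>m. adm \<pi> \<rho>p \<rho>m}"
  define S where "S = (\<lambda>k. push (axis k 1) 0 0) ` areas N \<union> (\<lambda>k. push (axis k (- 1)) 0 0) ` areas N
    \<union> (\<lambda>e. push 0 (axis e 1) 0) ` {e \<in> lines N. line_flow N \<phi> $ e = p_max N $ e}
    \<union> (\<lambda>e. push 0 0 (axis e 1)) ` {e \<in> lines N. line_flow N \<phi> $ e = p_min N $ e}"
  have push_inner: "push \<pi> \<rho>p \<rho>m \<bullet> h =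
      \<pi> \<bullet> (Chat N *v line_flow N h) + \<rho>p \<bullet> line_flow N h - \<rho>m \<bullet> line_flow N h" for \<pi> \<rho>p \<rho>m h
    by (simp add: push_def inner_line_flow[symmetric] inner_diff_left inner_add_left dot_lmul_matrix)
  have push_eqI: "w = push \<pi> \<rho>p \<rho>m" if "\<And>h. w \<bullet> h = push \<pi> \<rho>p \<rho>m \<bullet> h" for w \<pi> \<rho>p \<rho>m
    using that vector_eq_rdot by blast
  have K_I: "push \<pi> \<rho>p \<rho>m \<in> K" if "adm \<pi> \<rho>p \<rho>m" for \<pi> \<rho>p \<rho>m
    using that unfolding K_def by blast
  have "LB N *v lam \<in> convex_cone hull S"
  proof (rule farkas)
    show "finite S" by (simp add: S_def)
    fix h assume h: "\<And>s. s \<in> S \<Longrightarrow> s \<bullet> h \<le> 0"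
    have "(Chat N *v line_flow N h) $ k = 0" for k
    proof (cases "k \<in> areas N")
      case True
      then show ?thesis
        using h[of "push (axis k 1) 0 0"] h[of "push (axis k (- 1)) 0 0"]
        by (auto simp: S_def push_inner inner_axis' )
    next
      case False
      then show ?thesis unfolding Chat_mult_nth by (simp add: Chat_def)
    qed
    then have "Chat N *v line_flow N h = 0" by (simp add: vec_eq_iff)
    then have "lam \<bullet> (LB N *v h) \<le> 0"
      unfolding lam_def
    proof (rule vf_optimal_feasible_direction[OF wf A1 opt int])
      fix e assume "e \<in> lines N" "line_flow N \<phi> $ e = p_max N $ e"
      then show "line_flow N h $ e \<le> 0"
        using h[of "push 0 (axis e 1) 0"] by (auto simp: S_def push_inner inner_axis')
    next
      fix e assume "e \<in> lines N" "line_flow N \<phi> $ e = p_min N $ e"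
      then show "line_flow N h $ e \<ge> 0"
        using h[of "push 0 0 (axis e 1)"] by (auto simp: S_def push_inner inner_axis')
    qed
    then show "(LB N *v lam) \<bullet> h \<le> 0" by (simp add: inner_LB)
  qed
  moreover have "convex_cone hull S \<subseteq> K"
  proof (rule hull_minimal)
    show "S \<subseteq> K"
      unfolding S_def by (auto intro!: K_I simp: adm_def vec_on_def axis_def)
    have "push 0 0 0 = 0" by (simp add: push_def)
    then have "0 \<in> K" using K_I[of 0 0 0] by (simp add: adm_def vec_on_def)
    moreover have "x + y \<in> K" if x: "x \<in> K" and y: "y \<in> K" for x y
    proof -
      obtain \<pi> \<rho>p \<rho>m \<pi>' \<rho>p' \<rho>m' where
        "x = push \<pi> \<rho>p \<rho>m" "adm \<pi> \<rho>p \<rho>m" "y = push \<pi>' \<rho>p' \<rho>m'" "adm \<pi>' \<rho>p' \<rho>m'"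
        using x y unfolding K_def by blast
      moreover have "push \<pi> \<rho>p \<rho>m + push \<pi>' \<rho>p' \<rho>m' = push (\<pi> + \<pi>') (\<rho>p + \<rho>p') (\<rho>m + \<rho>m')"
        by (rule push_eqI) (simp add: push_inner inner_add_left)
      moreover have "adm (\<pi> + \<pi>') (\<rho>p + \<rho>p') (\<rho>m + \<rho>m')"
        using calculation by (simp add: adm_def vec_on_def)
      ultimately show ?thesis by (simp add: K_I)
    qed
    moreover have "c *\<^sub>R x \<in> K" if x: "x \<in> K" and c: "c \<ge> 0" for x c
    proof -
      obtain \<pi> \<rho>p \<rho>m where "x = push \<pi> \<rho>p \<rho>m" "adm \<pi> \<rho>p \<rho>m"
        using x unfolding K_def by blast
      moreover have "c *\<^sub>R push \<pi> \<rho>p \<rho>m = push (c *\<^sub>R \<pi>) (c *\<^sub>R \<rho>p) (c *\<^sub>R \<rho>m)"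
        by (rule push_eqI) (simp add: push_inner algebra_simps)
      moreover have "adm (c *\<^sub>R \<pi>) (c *\<^sub>R \<rho>p) (c *\<^sub>R \<rho>m)"
        using calculation c by (simp add: adm_def vec_on_def)
      ultimately show ?thesis by (simp add: K_I)
    qed
    ultimately show "convex_cone K" unfolding convex_cone_iff by blast
  qed
  ultimately obtain \<pi> \<rho>p \<rho>m where "LB N *v lam = push \<pi> \<rho>p \<rho>m" "adm \<pi> \<rho>p \<rho>m"
    unfolding K_def by blast
  then have "kkt N d \<phi> lam \<pi> \<rho>p \<rho>m"
    using int by (force simp: kkt_def virtual_phase_drift_def push_def adm_def lam_def)
  then show ?thesis by blast
qed

section \<open>Necessity of the optimality conditions\<close>

text \<open>Comparison with the multipliers constructed above shows that the given dual point also attains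
  the primal value. So the primal point minimizes the Lagrangian at the given multipliers, and
  complementary slackness holds because the Lagrangian cannot lie below the primal value.\<close>

lemma vf_primal_dual_optimal_imp_kkt:
  assumes wf: "wf_network N" and A1: "assumption1 N \<alpha>" and A2: "assumption2 N"
    and opt: "vf_primal_dual_optimal N (d, 0, \<phi>, P) (0, lam, \<pi>, \<rho>p, \<rho>m)"
  shows "kkt N d \<phi> lam \<pi> \<rho>p \<rho>m"
proof -
  let ?y = "(0, lam, \<pi>, \<rho>p, \<rho>m)" and ?q = "virtual_phase_drift N lam \<pi> \<rho>p \<rho>m"
  have primal: "is_arg_min (vf_objective N) (vf_feasible N) (d, 0, \<phi>, P)"
    and dual: "is_arg_max (vf_dual_objective N) (vf_dual_feasible N) ?y"
    using opt by (auto simp: vf_primal_dual_optimal_def)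
  have int: "d $ i \<in> interior (d_dom N i)" for i
    by (rule vf_optimal_imp_interior[OF wf A2 primal])
  have feas: "vf_feasible N (d, 0, \<phi>, P)" using primal unfolding is_arg_min_def by blast
  have P: "P \<in> vec_on (lines N)" using feas by simp
  have dual_feas: "vf_dual_feasible N ?y" using dual by (simp add: is_arg_max_def)
  obtain lam' \<pi>' \<rho>p' \<rho>m' where kkt': "kkt N d \<phi> lam' \<pi>' \<rho>p' \<rho>m'"
    using vf_optimal_imp_kkt[OF wf A1 primal int] by blast
  have dual_feas': "vf_dual_feasible N (0, lam', \<pi>', \<rho>p', \<rho>m')" using kkt' unfolding kkt_def by blast
  have "vf_objective N (d, 0, \<phi>, P) \<le> vf_dual_objective N (0, lam', \<pi>', \<rho>p', \<rho>m')"
    by (rule kkt_no_duality_gap[OF wf A1 feas kkt'])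
  also have "\<dots> \<le> vf_dual_objective N ?y"
    using dual dual_feas' unfolding is_arg_max_def by (meson not_le)
  finally have saddle: "vf_objective N (d, 0, \<phi>, P) \<le> vf_lagrangian N (d', \<omega>', \<phi>', P) ?y"
    for d' \<omega>' \<phi>'
    unfolding vf_dual_objective_def using P by (auto simp: le_INF_iff)
  have le: "\<rho>p \<bullet> (line_flow N \<phi> - p_max N) \<le> 0" "\<rho>m \<bullet> (p_min N - line_flow N \<phi>) \<le> 0"
    using dual_feas feas by (auto intro!: inner_nonpos_on[where S = "lines N"])
  have "LB N *v \<phi> = p_in N - d" "Chat N *v line_flow N \<phi> = p_hat N"
    using feas by auto
  then have lagr: "vf_lagrangian N (d, 0, \<phi>, P) ?y = ereal ((\<Sum>i\<in>UNIV. cost N i (d $ i))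
      + \<rho>p \<bullet> (line_flow N \<phi> - p_max N) + \<rho>m \<bullet> (p_min N - line_flow N \<phi>))"
    unfolding vf_lagrangian.simps vf_objective_interior[OF int] by simp
  then have slack: "\<rho>p \<bullet> (line_flow N \<phi> - p_max N) = 0" "\<rho>m \<bullet> (p_min N - line_flow N \<phi>) = 0"
    using saddle[of d 0 \<phi>] le
    by (auto simp: vf_objective_interior[OF int] simp del: vf_objective.simps vf_lagrangian.simps)
  then have min: "vf_lagrangian N (d, 0, \<phi>, P) ?y \<le> vf_lagrangian N (d', \<omega>', \<phi>', P) ?y" for d' \<omega>' \<phi>'
    using saddle[of d' \<omega>' \<phi>'] lagr
    by (simp add: vf_objective_interior[OF int] del: vf_objective.simps vf_lagrangian.simps)
  \<comment> \<open>The Lagrangian is affine in \<open>\<phi>\<close> with slope \<open>- ?q\<close>, so a minimizer forces the slope to vanish: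
    test with \<open>\<phi> + ?q\<close>.\<close>
  have "?q \<bullet> ?q \<le> 0"
    using min[of d 0 "\<phi> + ?q"]
    by (simp add: vf_lagrangian_interior[OF int] inner_add_right del: vf_lagrangian.simps)
  then have drift: "?q = 0" by (metis inner_eq_zero_iff inner_ge_zero order_antisym)
  have price: "deriv (cost N i) (d $ i) = lam $ i" for i
  proof -
    obtain e where e: "e > 0" "ball (d $ i) e \<subseteq> interior (d_dom N i)"
      using int[of i] open_interior open_contains_ball by blast
    \<comment> \<open>Changing the single coordinate \<open>i\<close> of \<open>d\<close> isolates the scalar problem of bus \<open>i\<close>.\<close>
    have "cost N i (d $ i) - lam $ i * d $ i \<le> cost N i t - lam $ i * t"
      if t: "t \<in> interior (d_dom N i)" for t
    proof -
      define d' where "d' = (\<chi> j. if j = i then t else d $ j)"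
      have int': "d' $ j \<in> interior (d_dom N j)" for j using t int by (simp add: d'_def)
      have rest: "(\<Sum>j\<in>UNIV. cost N j (x $ j) - lam $ j * x $ j) =
          (cost N i (x $ i) - lam $ i * x $ i) + (\<Sum>j\<in>UNIV - {i}. cost N j (x $ j) - lam $ j * x $ j)" for x
        by (simp add: sum.remove)
      have "(\<Sum>j\<in>UNIV - {i}. cost N j (d' $ j) - lam $ j * d' $ j) =
          (\<Sum>j\<in>UNIV - {i}. cost N j (d $ j) - lam $ j * d $ j)"
        by (intro sum.cong) (auto simp: d'_def)
      then show ?thesis
        using min[of d' 0 \<phi>] unfolding vf_lagrangian_interior[OF int] vf_lagrangian_interior[OF int']
          rest[of d] rest[of d'] by (simp add: d'_def)
    qed
    then have "\<forall>t. \<bar>d $ i - t\<bar> < e \<longrightarrow>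
        cost N i (d $ i) - lam $ i * d $ i \<le> cost N i t - lam $ i * t"
      using e(2) by (auto simp: dist_real_def subset_iff)
    moreover have "((\<lambda>t. cost N i t - lam $ i * t) has_real_derivative
        deriv (cost N i) (d $ i) - lam $ i) (at (d $ i))"
      using cost_derivatives(1)[OF A1 int[of i]] by (auto intro!: derivative_eq_intros)
    ultimately have "deriv (cost N i) (d $ i) - lam $ i = 0"
      using e(1) by (intro DERIV_local_min[of _ _ "d $ i" e])
    then show ?thesis by simp
  qed
  have p: "\<rho>p \<in> vec_on (lines N)" "\<rho>m \<in> vec_on (lines N)"
    and nonneg: "\<And>e. e \<in> lines N \<Longrightarrow> \<rho>p $ e \<ge> 0" "\<And>e. e \<in> lines N \<Longrightarrow> \<rho>m $ e \<ge> 0"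
    using dual_feas by auto
  have nonpos: "\<And>e. e \<in> lines N \<Longrightarrow> (line_flow N \<phi> - p_max N) $ e \<le> 0"
      "\<And>e. e \<in> lines N \<Longrightarrow> (p_min N - line_flow N \<phi>) $ e \<le> 0"
    using feas by auto
  have "line_flow N \<phi> $ e = p_max N $ e" if "\<rho>p $ e > 0" for e
    using inner_eq_0_imp_complementary[OF p(1) nonneg(1) nonpos(1) slack(1), of e] that by simp
  moreover have "line_flow N \<phi> $ e = p_min N $ e" if "\<rho>m $ e > 0" for e
    using inner_eq_0_imp_complementary[OF p(2) nonneg(2) nonpos(2) slack(2), of e] that by simp
  ultimately show ?thesis
    unfolding kkt_def using int price drift dual_feas by blast
qed

section \<open>Equilibria of the closed loop\<close>

lemma pos_proj_eq_0_iff: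
  assumes "u \<ge> 0"
  shows "pos_proj u a = 0 \<longleftrightarrow> a \<le> 0 \<and> (u > 0 \<longrightarrow> a = 0)"
  using assms by (auto simp: pos_proj_def)

lemma virtual_phase_drift_nth:
  assumes "wf_network N"
  shows "virtual_phase_drift N lam \<pi> \<rho>p \<rho>m $ i =
    (\<Sum>j\<in>nbrs N i. susc N i j * (lam $ i - lam $ j))
    - (\<Sum>k\<in>areas N. \<Sum>e\<in>border N k. Cmat N $ i $ e * Bmat N $ e $ e * Chat N $ k $ e * \<pi> $ k)
    - (\<Sum>e\<in>lines N. Cmat N $ i $ e * Bmat N $ e $ e * (\<rho>p $ e - \<rho>m $ e))"
proof -
  let ?c = "\<lambda>e. Cmat N $ i $ e * Bmat N $ e $ e"
  have "(Bmat N *v u) $ e = Bmat N $ e $ e * u $ e" for u e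
    unfolding Bmat_def diag_mat_mult_nth by (simp add: diag_mat_def)
  then have weighted: "(Cmat N *v (Bmat N *v u)) $ i = (\<Sum>e\<in>lines N. ?c e * u $ e)" for u
    by (simp add: Cmat_mult_nth mult.assoc)
  have "(\<pi> v* Chat N) $ e = (\<Sum>k\<in>areas N. Chat N $ k $ e * \<pi> $ k)" for e
    unfolding vector_matrix_mult_def
    by (simp, rule sum.mono_neutral_cong_right) (auto simp: Chat_def)
  then have "(\<Sum>e\<in>lines N. ?c e * (\<pi> v* Chat N) $ e) =
      (\<Sum>e\<in>lines N. \<Sum>k\<in>areas N. ?c e * Chat N $ k $ e * \<pi> $ k)"
    by (simp add: sum_distrib_left mult.assoc)
  also have "\<dots> = (\<Sum>k\<in>areas N. \<Sum>e\<in>lines N. ?c e * Chat N $ k $ e * \<pi> $ k)"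
    by (rule sum.swap)
  also have "\<dots> = (\<Sum>k\<in>areas N. \<Sum>e\<in>border N k. ?c e * Chat N $ k $ e * \<pi> $ k)"
    by (intro sum.cong refl sum.mono_neutral_right) (auto simp: Chat_def border_def)
  finally show ?thesis
    unfolding virtual_phase_drift_def vector_minus_component weighted LB_mult_nth[OF assms]
    by (simp add: algebra_simps sum.distrib sum_subtractf)
qed

lemma D_mat_mult_nth: "(D_mat N *v \<omega>) $ i = damp N $ i * \<omega> $ i"
  unfolding D_mat_def by (rule diag_mat_mult_nth)

text \<open>Subtracting the two balances leaves \<open>D \<omega> = L\<^sub>B \<phi> - C P\<close>, whose entries sum to zero, whereas \<open>\<omega>\<close>
  is constant and \<open>D\<close> is positive.\<close>

lemma synchronized_balanced_imp_zero_frequency: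
  assumes wf: "wf_network N"
    and sync: "\<And>i j. (i, j) \<in> lines N \<Longrightarrow> \<omega> $ i = \<omega> $ j"
    and flow: "p_in N - (d + D_mat N *v \<omega>) = Cmat N *v P"
    and virtual: "p_in N - d = LB N *v \<phi>"
  shows "\<omega> = 0"
proof -
  have "D_mat N *v \<omega> = LB N *v \<phi> - Cmat N *v P"
    using flow virtual by (simp add: algebra_simps)
  then have "(\<Sum>i\<in>UNIV. (D_mat N *v \<omega>) $ i) = 0"
    by (simp add: LB_eq_line_flow sum_subtractf sum_Cmat_mult[OF wf])
  then have sum: "(\<Sum>j\<in>UNIV. damp N $ j * \<omega> $ j) = 0" by (simp add: D_mat_mult_nth)
  have "\<omega> $ i = 0" for i
  proof -
    have "(\<Sum>j\<in>UNIV. damp N $ j) * \<omega> $ i = (\<Sum>j\<in>UNIV. damp N $ j * \<omega> $ j)"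
      unfolding sum_distrib_right
      by (intro sum.cong refl arg_cong[where f = "\<lambda>c. _ * c"] constant_on_network[OF wf sync])
    then have "(\<Sum>j\<in>UNIV. damp N $ j) * \<omega> $ i = 0" using sum by simp
    moreover have "(\<Sum>j\<in>UNIV. damp N $ j) > 0"
      using wf by (intro sum_pos) (auto simp: wf_network_def)
    ultimately show ?thesis by simp
  qed
  then show ?thesis by (simp add: vec_eq_iff)
qed

text \<open>The guarantee that the load response is a genuine solution of \<open>c\<^sub>i'(d\<^sub>i) = p\<close>: a priori
  \<open>inv_into\<close> is arbitrary outside the range of \<open>c\<^sub>i'\<close>.\<close>

lemma load_response_iff:
  assumes "assumption1 N \<alpha>" "interior (d_dom N i) \<noteq> {}"
  shows "x = inv_into (interior (d_dom N i)) (deriv (cost N i)) p \<longleftrightarrow>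
    x \<in> interior (d_dom N i) \<and> deriv (cost N i) x = p"
proof -
  have inj: "inj_on (deriv (cost N i)) (interior (d_dom N i))"
    and range: "p \<in> deriv (cost N i) ` interior (d_dom N i)"
    using marginal_cost_bij_betw[OF assms] by (simp_all add: bij_betw_def)
  show ?thesis
    using inv_into_into[OF range] f_inv_into_f[OF range] inv_into_f_f[OF inj, of x] by metis
qed

text \<open>Each block of closed-loop equations, with derivative zero and the positive gains cancelled, is one
  of the conditions on the right; \<open>\<omega> = 0\<close> follows from the line equations and the two balances.\<close>

lemma equilibrium_iff_kkt:
  assumes wf: "wf_network N" and A1: "assumption1 N \<alpha>" and A2: "assumption2 N"
    and gains: "positive_gains N g"
  shows "equilibrium N g (d, \<omega>, \<phi>, P, lam, \<pi>, \<rho>p, \<rho>m) \<longleftrightarrow>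
    \<omega> = 0 \<and> vf_feasible N (d, 0, \<phi>, P) \<and> kkt N d \<phi> lam \<pi> \<rho>p \<rho>m"
proof -
  let ?X = "p_in N - (d + D_mat N *v \<omega>) = Cmat N *v P"
  let ?lim = "\<forall>e\<in>lines N. p_min N $ e \<le> line_flow N \<phi> $ e \<and> line_flow N \<phi> $ e \<le> p_max N $ e"
  let ?slack = "\<forall>e\<in>lines N. (\<rho>p $ e > 0 \<longrightarrow> line_flow N \<phi> $ e = p_max N $ e) \<and>
                   (\<rho>m $ e > 0 \<longrightarrow> line_flow N \<phi> $ e = p_min N $ e)"
  have ne: "interior (d_dom N i) \<noteq> {}" for i using A2 unfolding assumption2_def by blast
  \<comment> \<open>The free conjunct \<open>R\<close> in this and in the fact on line limits lets two adjacent equations be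
    rewritten at once inside the long conjunction that defines the closed loop.\<close>
  have swing: "(\<forall>i\<in>gens N. inertia N i * 0 $ i =
        p_in N $ i - (d $ i + damp N $ i * \<omega> $ i) - (\<Sum>e\<in>lines N. Cmat N $ i $ e * P $ e)) \<and>
     (\<forall>i\<in>loads N. 0 =
        p_in N $ i - (d $ i + damp N $ i * \<omega> $ i) - (\<Sum>e\<in>lines N. Cmat N $ i $ e * P $ e)) \<and> R \<longleftrightarrow> ?X \<and> R" for R
  proof -
    have "i \<in> gens N \<or> i \<in> loads N" for i using wf unfolding wf_network_def by blast
    then show ?thesis
      by (auto simp: vec_eq_iff D_mat_mult_nth Cmat_mult_nth)
  qed
  have flows: "(\<forall>(i, j)\<in>lines N. 0 $ (i, j) = susc N i j * (\<omega> $ i - \<omega> $ j)) \<longleftrightarrow>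
      (\<forall>i j. (i, j) \<in> lines N \<longrightarrow> \<omega> $ i = \<omega> $ j)"
    using wf unfolding wf_network_def by fastforce
  have virtual: "(\<forall>i. 0 $ i = g_lam g i *
        (p_in N $ i - d $ i - (\<Sum>j\<in>nbrs N i. susc N i j * (\<phi> $ i - \<phi> $ j)))) \<longleftrightarrow>
      p_in N - d = LB N *v \<phi>"
  proof -
    have "g_lam g i \<noteq> 0" for i using gains unfolding positive_gains_def by (metis less_irrefl)
    then show ?thesis by (simp add: vec_eq_iff LB_mult_nth[OF wf] eq_commute[of 0])
  qed
  have area: "(\<forall>k\<in>areas N. 0 $ k = g_pi g k *
        ((\<Sum>(i, j)\<in>border N k. Chat N $ k $ (i, j) * susc N i j * (\<phi> $ i - \<phi> $ j)) - p_hat N $ k)) \<longleftrightarrow>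
      Chat N *v line_flow N \<phi> = p_hat N"
  proof -
    have nz: "g_pi g k \<noteq> 0" if "k \<in> areas N" for k
      using gains that unfolding positive_gains_def by (metis less_irrefl)
    have "(Chat N *v line_flow N \<phi>) $ k =
        (\<Sum>(i, j)\<in>border N k. Chat N $ k $ (i, j) * susc N i j * (\<phi> $ i - \<phi> $ j))" for k
      unfolding Chat_mult_nth
      by (intro sum.cong refl) (auto simp: line_flow_nth[OF wf] border_def)
    moreover have "(Chat N *v line_flow N \<phi>) $ k = p_hat N $ k" if "k \<notin> areas N" for k
      using that wf unfolding Chat_mult_nth by (simp add: Chat_def wf_network_def vec_on_def)
    ultimately show ?thesis using nz unfolding vec_eq_iff by (auto simp: eq_commute[of 0])
  qed
  have limits: "(\<forall>(i, j)\<in>lines N. 0 $ (i, j) = g_rhop g (i, j) *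
        pos_proj (\<rho>p $ (i, j)) (susc N i j * (\<phi> $ i - \<phi> $ j) - p_max N $ (i, j))) \<and>
     (\<forall>(i, j)\<in>lines N. 0 $ (i, j) = g_rhom g (i, j) *
        pos_proj (\<rho>m $ (i, j)) (p_min N $ (i, j) - susc N i j * (\<phi> $ i - \<phi> $ j))) \<and> R \<longleftrightarrow>
      (?lim \<and> ?slack) \<and> R"
    if nonneg: "\<forall>e\<in>lines N. \<rho>p $ e \<ge> 0 \<and> \<rho>m $ e \<ge> 0" for R
  proof -
    have edge: "(0 = g_rhop g (i, j) *
          pos_proj (\<rho>p $ (i, j)) (susc N i j * (\<phi> $ i - \<phi> $ j) - p_max N $ (i, j)) \<longleftrightarrow>
        line_flow N \<phi> $ (i, j) \<le> p_max N $ (i, j) \<and>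
          (\<rho>p $ (i, j) > 0 \<longrightarrow> line_flow N \<phi> $ (i, j) = p_max N $ (i, j))) \<and>
      (0 = g_rhom g (i, j) *
          pos_proj (\<rho>m $ (i, j)) (p_min N $ (i, j) - susc N i j * (\<phi> $ i - \<phi> $ j)) \<longleftrightarrow>
        p_min N $ (i, j) \<le> line_flow N \<phi> $ (i, j) \<and>
          (\<rho>m $ (i, j) > 0 \<longrightarrow> line_flow N \<phi> $ (i, j) = p_min N $ (i, j)))"
      if "(i, j) \<in> lines N" for i j
    proof -
      have "g_rhop g (i, j) \<noteq> 0" "g_rhom g (i, j) \<noteq> 0"
        using gains that unfolding positive_gains_def by (metis less_irrefl)+
      then show ?thesis
        using that nonneg
        by (auto simp: eq_commute[of 0] pos_proj_eq_0_iff line_flow_nth[OF wf])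
    qed
    show ?thesis using edge by (simp add: Ball_def split_paired_all) blast
  qed
  have drift: "(\<forall>i. 0 $ i = g_phi g i *
        ((\<Sum>j\<in>nbrs N i. susc N i j * (lam $ i - lam $ j))
         - (\<Sum>k\<in>areas N. \<Sum>e\<in>border N k.
              Cmat N $ i $ e * Bmat N $ e $ e * Chat N $ k $ e * \<pi> $ k)
         - (\<Sum>e\<in>lines N. Cmat N $ i $ e * Bmat N $ e $ e * (\<rho>p $ e - \<rho>m $ e)))) \<longleftrightarrow>
      virtual_phase_drift N lam \<pi> \<rho>p \<rho>m = 0"
  proof -
    have "g_phi g i \<noteq> 0" for i using gains unfolding positive_gains_def by (metis less_irrefl)
    then show ?thesis
      unfolding virtual_phase_drift_nth[OF wf, symmetric] by (simp add: vec_eq_iff eq_commute[of 0])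
  qed
  have "equilibrium N g (d, \<omega>, \<phi>, P, lam, \<pi>, \<rho>p, \<rho>m) \<longleftrightarrow>
      P \<in> vec_on (lines N) \<and> vf_dual_feasible N (0, lam, \<pi>, \<rho>p, \<rho>m) \<and>
      ?X \<and> (\<forall>i j. (i, j) \<in> lines N \<longrightarrow> \<omega> $ i = \<omega> $ j) \<and> p_in N - d = LB N *v \<phi> \<and>
      Chat N *v line_flow N \<phi> = p_hat N \<and> (?lim \<and> ?slack) \<and>
      virtual_phase_drift N lam \<pi> \<rho>p \<rho>m = 0 \<and>
      (\<forall>i. d $ i \<in> interior (d_dom N i) \<and> deriv (cost N i) (d $ i) = lam $ i + \<omega> $ i)"
  proof (cases "\<forall>e\<in>lines N. \<rho>p $ e \<ge> 0 \<and> \<rho>m $ e \<ge> 0")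
    case True
    show ?thesis
      unfolding equilibrium_def zero_prod_def closed_loop.simps state_space.simps
        vf_dual_feasible.simps swing flows virtual area limits[OF True] drift
        load_response_iff[OF A1 ne]
      by (rule iffI; elim conjE; intro conjI; assumption)
  next
    case False
    then show ?thesis by (simp only: equilibrium_def state_space.simps vf_dual_feasible.simps) blast
  qed
  also have "\<dots> \<longleftrightarrow> \<omega> = 0 \<and> vf_feasible N (d, 0, \<phi>, P) \<and> kkt N d \<phi> lam \<pi> \<rho>p \<rho>m"
    using synchronized_balanced_imp_zero_frequency[OF wf, of \<omega> d P \<phi>]
    unfolding kkt_def vf_feasible.simps by auto
  finally show ?thesis .
qed

theorem theorem8:
  fixes N :: "('n::finite, 'k::finite) network"
    and g :: "('n, 'k) gains"
    and \<alpha> :: real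
    and d \<omega> \<phi> lam :: "real ^ 'n"
    and P \<rho>p \<rho>m :: "real ^ ('n \<times> 'n)"
    and \<pi> :: "real ^ 'k"
  assumes "wf_network N"
    and "assumption1 N \<alpha>"
    and "assumption2 N"
    and "positive_gains N g"
  shows "equilibrium N g (d, \<omega>, \<phi>, P, lam, \<pi>, \<rho>p, \<rho>m) \<longleftrightarrow>
    (\<exists>\<theta> \<nu>. olc_optimal N (d, \<omega>, \<theta>) \<and>
       vf_primal_dual_optimal N (d, \<omega>, \<phi>, P) (\<nu>, lam, \<pi>, \<rho>p, \<rho>m) \<and>
       \<omega> = \<nu> \<and>
       Cmat N *v P = LB N *v \<theta> \<and>
       transpose (Cmat N) *v \<theta> = transpose (Cmat N) *v \<phi>)"
proof
  assume "equilibrium N g (d, \<omega>, \<phi>, P, lam, \<pi>, \<rho>p, \<rho>m)"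
  then have \<omega>: "\<omega> = 0" and feas: "vf_feasible N (d, 0, \<phi>, P)" and kkt: "kkt N d \<phi> lam \<pi> \<rho>p \<rho>m"
    using equilibrium_iff_kkt[OF assms] by auto
  have opt: "vf_primal_dual_optimal N (d, 0, \<phi>, P) (0, lam, \<pi>, \<rho>p, \<rho>m)"
    by (rule kkt_imp_vf_primal_dual_optimal[OF assms(1,2) feas kkt])
  then have "olc_optimal N (d, 0, \<phi>)"
    using vf_optimal_imp_olc_optimal[OF assms(1)] unfolding vf_primal_dual_optimal_def by blast
  moreover have "Cmat N *v P = LB N *v \<phi>" using feas by auto
  ultimately show "\<exists>\<theta> \<nu>. olc_optimal N (d, \<omega>, \<theta>) \<and>
       vf_primal_dual_optimal N (d, \<omega>, \<phi>, P) (\<nu>, lam, \<pi>, \<rho>p, \<rho>m) \<and>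
       \<omega> = \<nu> \<and>
       Cmat N *v P = LB N *v \<theta> \<and>
       transpose (Cmat N) *v \<theta> = transpose (Cmat N) *v \<phi>"
    using opt \<omega> by blast
next
  assume "\<exists>\<theta> \<nu>. olc_optimal N (d, \<omega>, \<theta>) \<and>
       vf_primal_dual_optimal N (d, \<omega>, \<phi>, P) (\<nu>, lam, \<pi>, \<rho>p, \<rho>m) \<and>
       \<omega> = \<nu> \<and>
       Cmat N *v P = LB N *v \<theta> \<and>
       transpose (Cmat N) *v \<theta> = transpose (Cmat N) *v \<phi>"
  then obtain \<theta> where "olc_optimal N (d, \<omega>, \<theta>)"
    and opt: "vf_primal_dual_optimal N (d, \<omega>, \<phi>, P) (\<omega>, lam, \<pi>, \<rho>p, \<rho>m)"
    by blast
  then have \<omega>: "\<omega> = 0" by (simp add: is_arg_min_def)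
  have "kkt N d \<phi> lam \<pi> \<rho>p \<rho>m"
    using vf_primal_dual_optimal_imp_kkt[OF assms(1-3)] opt unfolding \<omega> by blast
  moreover have "vf_feasible N (d, 0, \<phi>, P)"
    using opt unfolding vf_primal_dual_optimal_def is_arg_min_def \<omega> by blast
  ultimately show "equilibrium N g (d, \<omega>, \<phi>, P, lam, \<pi>, \<rho>p, \<rho>m)"
    using equilibrium_iff_kkt[OF assms] \<omega> by blast
qed

end
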